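(* Let $\mathbb{A}$ be a left closed double category with companions. Then the internal hom, given on objects by $(y,z)\mapsto y\backslash z$ and on morphisms by $(\beta,\gamma)\mapsto \beta\backslash\gamma$, is a functor $\backslash\colon \mathbf{TC}(\mathbb{A})\to\mathbf{A}_1$.
   Context: Double categories. A double category $\mathbb{A}$ has objects, horizontal arrows (composed strictly: composite $gf$, identity $1_A$), vertical arrows $v\colon A\nrightarrow C$ (composite $w\bullet v$ meaning $v$ first, identity $\mathrm{id}_A$; vertical composition is associative up to coherent isomorphism, vertical identities are taken strict) and cells. A cell has a top $f\colon A\to B$, a bottom $g\colon C\to D$ (horizontal arrows), a left side $v\colon A\nrightarrow C$ and a right side $w\colon B\nrightarrow D$ (vertical arrows). $\alpha\mid\beta$ denotes horizontal pasting ($\alpha$ left of $\beta$) and $\frac{\alpha}{\beta}$ vertical pasting ($\alpha$ above $\beta$); $1_v$ is the horizontal identity cell on $v$. A globular cell $v\Rightarrow w$ has left $v$, right $w$ and identity top and bottom. Associativity isomorphisms are suppressed. Companions. A companion of $f\colon A\to B$ is a vertical arrow $f_*\colon A\nrightarrow B$ with binding cells $\psi_f$ (top $1_A$, left $\mathrm{id}_A$, right $f_*$, bottom $f$) and $\chi_f$ (top $f$, left $f_*$, right $\mathrm{id}_B$, bottom $1_B$) with $\psi_f\mid\chi_f=\mathrm{id}_f$ (vertical identity cell) and $\frac{\psi_f}{\chi_f}=1_{f_*}$. Companions are chosen, with $(1_A)_*=\mathrm{id}_A$; there are canonical isomorphisms $(hf)_*\cong h_*\bullet f_*$. Retrocells.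 A retrocell with top $f\colon A\to B$, left $v\colon A\nrightarrow C$, right $w\colon B\nrightarrow D$, bottom $g\colon C\to D$ is a globular cell $w\bullet f_*\Rightarrow g_*\bullet v$. The horizontal composite $\beta\alpha$ of $\alpha\colon w\bullet f_*\Rightarrow g_*\bullet v$ and $\beta\colon x\bullet h_*\Rightarrow k_*\bullet w$ is $x\bullet(hf)_*\cong x\bullet h_*\bullet f_*\Rightarrow k_*\bullet w\bullet f_*\Rightarrow k_*\bullet g_*\bullet v\cong(kg)_*\bullet v$; the horizontal identity retrocell on $v$ is the identity globular cell on $v$. Left closed. $\mathbb{A}$ is left closed (has strong left homs) if for all $y\colon B\nrightarrow C$ and $z\colon A\nrightarrow C$ there is a vertical arrow $y\backslash z\colon A\nrightarrow B$ and a globular cell $\epsilon\colon y\bullet(y\backslash z)\Rightarrow z$ such that for all $f\colon A'\to A$, $x\colon A'\nrightarrow B$ and every cell $\alpha$ with top $f$, left $y\bullet x$, right $z$, bottom $1_C$ there is a unique cell $\beta$ with top $f$, left $x$, right $y\backslash z$, bottom $1_B$ such that $\frac{\beta}{1_y}\,\big|\,\epsilon=\alpha$. Categories. $\mathbf{A}_1$ is the category whose objects are vertical arrows of $\mathbb{A}$ and whose morphisms $v\to w$ are cells with left $v$ and right $w$, composed horizontally. $\mathbf{TC}(\mathbb{A})$ (twisted cospans) has as objects pairs $(y,z)$ of vertical arrows $y\colon B\nrightarrow C$, $z\colon A\nrightarrow C$ with common codomain; a morphism $(y,z)\to(y',z')$, with $y'\colon B'\nrightarrow C'$, $z'\colon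 A'\nrightarrow C'$, consists of horizontal arrows $a\colon A\to A'$, $b\colon B\to B'$, $c\colon C\to C'$, a retrocell $\beta$ with top $b$, left $y$, right $y'$, bottom $c$ (i.e. $\beta\colon y'\bullet b_*\Rightarrow c_*\bullet y$) and a cell $\gamma$ with top $a$, left $z$, right $z'$, bottom $c$; composition is componentwise horizontal composition of retrocells and of cells. The cell $\beta\backslash\gamma$ is the unique cell $\xi$ with top $a$, left $y\backslash z$, right $y'\backslash z'$, bottom $b$ such that the vertical pasting of $\xi$, $\chi_b$, $1_{y'}$ (top to bottom), followed horizontally on the right by $\epsilon'\colon y'\bullet(y'\backslash z')\Rightarrow z'$, equals the horizontal pasting (left to right) of $\beta\bullet 1_{y\backslash z}\colon y'\bullet b_*\bullet (y\backslash z)\Rightarrow c_*\bullet y\bullet(y\backslash z)$, $1_{c_*}\bullet\epsilon\colon c_*\bullet y\bullet (y\backslash z)\Rightarrow c_*\bullet z$, and $\frac{\gamma}{\chi_c}$. *)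

theory Defs
  imports Main
begin

section \<open>Categories and functors\<close>

record ('o, 'm) cat =
  Obj :: "'o set"
  Arr :: "'m set"
  Dom :: "'m \<Rightarrow> 'o"
  Cod :: "'m \<Rightarrow> 'o"
  Id :: "'o \<Rightarrow> 'm"
  Comp :: "'m \<Rightarrow> 'm \<Rightarrow> 'm"  \<comment> \<open>\<open>Comp C g f\<close> is \<open>g\<close> after \<open>f\<close>\<close>

locale category =
  fixes C :: "('o, 'm) cat"
  assumes dom_obj: "f \<in> Arr C \<Longrightarrow> Dom C f \<in> Obj C"
    and cod_obj: "f \<in> Arr C \<Longrightarrow> Cod C f \<in> Obj C"
    and id_arr: "X \<in> Obj C \<Longrightarrow> Id C X \<in> Arr C"
    and dom_id: "X \<in> Obj C \<Longrightarrow> Dom C (Id C X) = X"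
    and cod_id: "X \<in> Obj C \<Longrightarrow> Cod C (Id C X) = X"
    and comp_arr: "\<lbrakk>f \<in> Arr C; g \<in> Arr C; Cod C f = Dom C g\<rbrakk> \<Longrightarrow> Comp C g f \<in> Arr C"
    and dom_comp: "\<lbrakk>f \<in> Arr C; g \<in> Arr C; Cod C f = Dom C g\<rbrakk> \<Longrightarrow> Dom C (Comp C g f) = Dom C f"
    and cod_comp: "\<lbrakk>f \<in> Arr C; g \<in> Arr C; Cod C f = Dom C g\<rbrakk> \<Longrightarrow> Cod C (Comp C g f) = Cod C g"
    and comp_id: "f \<in> Arr C \<Longrightarrow> Comp C f (Id C (Dom C f)) = f"
    and id_comp: "f \<in> Arr C \<Longrightarrow> Comp C (Id C (Cod C f)) f = f"
    and comp_assoc: "\<lbrakk>f \<in> Arr C; g \<in> Arr C; h \<in> Arr C; Cod C f = Dom C g; Cod C g = Dom C h\<rbrakk>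
          \<Longrightarrow> Comp C h (Comp C g f) = Comp C (Comp C h g) f"

locale cat_functor = C: category C + D: category D
  for C :: "('o, 'm) cat" and D :: "('p, 'n) cat" +
  fixes Fobj :: "'o \<Rightarrow> 'p" and Farr :: "'m \<Rightarrow> 'n"
  assumes obj_map: "X \<in> Obj C \<Longrightarrow> Fobj X \<in> Obj D"
    and arr_map: "f \<in> Arr C \<Longrightarrow> Farr f \<in> Arr D"
    and dom_map: "f \<in> Arr C \<Longrightarrow> Dom D (Farr f) = Fobj (Dom C f)"
    and cod_map: "f \<in> Arr C \<Longrightarrow> Cod D (Farr f) = Fobj (Cod C f)"
    and id_map: "X \<in> Obj C \<Longrightarrow> Farr (Id C X) = Id D (Fobj X)"
    and comp_map: "\<lbrakk>f \<in> Arr C; g \<in> Arr C; Cod C f = Dom C g\<rbrakk>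
          \<Longrightarrow> Farr (Comp C g f) = Comp D (Farr g) (Farr f)"

section \<open>Double categories\<close>

text \<open>
  Conventions: \<open>g \<odot> f\<close> is the horizontal composite \<open>gf\<close>; \<open>w \<bullet> v\<close> is the vertical composite,
  \<open>v\<close> first; \<open>\<alpha> \<parallel> \<beta>\<close> is horizontal pasting, \<open>\<alpha>\<close> on the left; \<open>\<alpha> \<oslash> \<beta>\<close> is vertical pasting,
  \<open>\<alpha>\<close> on top, so that the left side of \<open>\<alpha> \<oslash> \<beta>\<close> is the left side of \<open>\<beta>\<close> after that of \<open>\<alpha>\<close>.
  \<open>hidc v\<close> is the horizontal identity cell $1_v$ on a vertical arrow, \<open>vidc f\<close> the vertical
  identity cell $\mathrm{id}_f$ on a horizontal arrow. Operations matter only on composable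
  arguments from the carrier sets.
\<close>

record ('o, 'h, 'v, 'c) dblcat =
  objs :: "'o set"
  hors :: "'h set"
  vers :: "'v set"
  cells :: "'c set"
  hdom :: "'h \<Rightarrow> 'o"
  hcod :: "'h \<Rightarrow> 'o"
  hid :: "'o \<Rightarrow> 'h"
  hcomp :: "'h \<Rightarrow> 'h \<Rightarrow> 'h" (infixl "\<odot>\<index>" 70)
  vdom :: "'v \<Rightarrow> 'o"
  vcod :: "'v \<Rightarrow> 'o"
  vid :: "'o \<Rightarrow> 'v"
  vcomp :: "'v \<Rightarrow> 'v \<Rightarrow> 'v" (infixl "\<bullet>\<index>" 70)
  ctop :: "'c \<Rightarrow> 'h"
  cleft :: "'c \<Rightarrow> 'v"
  cright :: "'c \<Rightarrow> 'v"
  cbot :: "'c \<Rightarrow> 'h"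
  hidc :: "'v \<Rightarrow> 'c"
  vidc :: "'h \<Rightarrow> 'c"
  hpaste :: "'c \<Rightarrow> 'c \<Rightarrow> 'c" (infixl "\<parallel>\<index>" 60)
  vpaste :: "'c \<Rightarrow> 'c \<Rightarrow> 'c" (infixl "\<oslash>\<index>" 65)
  assoc :: "'v \<Rightarrow> 'v \<Rightarrow> 'v \<Rightarrow> 'c"
  assoc_inv :: "'v \<Rightarrow> 'v \<Rightarrow> 'v \<Rightarrow> 'c"

context
  fixes A :: "('o, 'h, 'v, 'c, 'x) dblcat_scheme" (structure)
begin

definition is_hor :: "'h \<Rightarrow> 'o \<Rightarrow> 'o \<Rightarrow> bool" where
  "is_hor f X Y \<longleftrightarrow> f \<in> hors A \<and> hdom A f = X \<and> hcod A f = Y"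

definition is_ver :: "'v \<Rightarrow> 'o \<Rightarrow> 'o \<Rightarrow> bool" where
  "is_ver v X Y \<longleftrightarrow> v \<in> vers A \<and> vdom A v = X \<and> vcod A v = Y"

text \<open>\<open>is_cell \<alpha> f v w g\<close>: the cell \<open>\<alpha>\<close> has top \<open>f\<close>, left \<open>v\<close>, right \<open>w\<close>, bottom \<open>g\<close>.\<close>

definition is_cell :: "'c \<Rightarrow> 'h \<Rightarrow> 'v \<Rightarrow> 'v \<Rightarrow> 'h \<Rightarrow> bool" where
  "is_cell \<alpha> f v w g \<longleftrightarrow>
     \<alpha> \<in> cells A \<and> ctop A \<alpha> = f \<and> cleft A \<alpha> = v \<and> cright A \<alpha> = w \<and> cbot A \<alpha> = g"

definition globular :: "'c \<Rightarrow> 'v \<Rightarrow> 'v \<Rightarrow> bool" where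
  "globular \<alpha> v w \<longleftrightarrow> is_cell \<alpha> (hid A (vdom A v)) v w (hid A (vcod A v))"

end

text \<open>Strict horizontally, with strict vertical identities, and associative vertically up to the
  globular isomorphisms \<open>assoc x w v : (x \<bullet> w) \<bullet> v \<Rightarrow> x \<bullet> (w \<bullet> v)\<close>. As the vertical unit
  isomorphisms are identities, \<open>triangle\<close> is the usual triangle axiom.\<close>

locale double_category =
  fixes A :: "('o, 'h, 'v, 'c, 'x) dblcat_scheme" (structure)
  \<comment> \<open>objects and horizontal arrows\<close>
  assumes hdom_obj: "f \<in> hors A \<Longrightarrow> hdom A f \<in> objs A"
    and hcod_obj: "f \<in> hors A \<Longrightarrow> hcod A f \<in> objs A"
    and hid_hor: "X \<in> objs A \<Longrightarrow> is_hor A (hid A X) X X"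
    and hcomp_hor: "\<lbrakk>is_hor A f X Y; is_hor A g Y Z\<rbrakk> \<Longrightarrow> is_hor A (g \<odot> f) X Z"
    and hcomp_hid: "is_hor A f X Y \<Longrightarrow> f \<odot> hid A X = f"
    and hid_hcomp: "is_hor A f X Y \<Longrightarrow> hid A Y \<odot> f = f"
    and hcomp_assoc: "\<lbrakk>is_hor A f W X; is_hor A g X Y; is_hor A h Y Z\<rbrakk>
          \<Longrightarrow> (h \<odot> g) \<odot> f = h \<odot> (g \<odot> f)"
  \<comment> \<open>vertical arrows\<close>
    and vdom_obj: "v \<in> vers A \<Longrightarrow> vdom A v \<in> objs A"
    and vcod_obj: "v \<in> vers A \<Longrightarrow> vcod A v \<in> objs A"
    and vid_ver: "X \<in> objs A \<Longrightarrow> is_ver A (vid A X) X X"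
    and vcomp_ver: "\<lbrakk>is_ver A v X Y; is_ver A w Y Z\<rbrakk> \<Longrightarrow> is_ver A (w \<bullet> v) X Z"
    and vcomp_vid: "is_ver A v X Y \<Longrightarrow> v \<bullet> vid A X = v"
    and vid_vcomp: "is_ver A v X Y \<Longrightarrow> vid A Y \<bullet> v = v"
  \<comment> \<open>boundaries of cells\<close>
    and ctop_hor: "\<alpha> \<in> cells A \<Longrightarrow> is_hor A (ctop A \<alpha>) (vdom A (cleft A \<alpha>)) (vdom A (cright A \<alpha>))"
    and cbot_hor: "\<alpha> \<in> cells A \<Longrightarrow> is_hor A (cbot A \<alpha>) (vcod A (cleft A \<alpha>)) (vcod A (cright A \<alpha>))"
    and cleft_ver: "\<alpha> \<in> cells A \<Longrightarrow> cleft A \<alpha> \<in> vers A"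
    and cright_ver: "\<alpha> \<in> cells A \<Longrightarrow> cright A \<alpha> \<in> vers A"
  \<comment> \<open>horizontal pasting\<close>
    and hidc_cell: "is_ver A v X Y \<Longrightarrow> is_cell A (hidc A v) (hid A X) v v (hid A Y)"
    and hpaste_cell: "\<lbrakk>is_cell A \<alpha> f v w g; is_cell A \<beta> h w x k\<rbrakk>
          \<Longrightarrow> is_cell A (\<alpha> \<parallel> \<beta>) (h \<odot> f) v x (k \<odot> g)"
    and hidc_hpaste: "is_cell A \<alpha> f v w g \<Longrightarrow> hidc A v \<parallel> \<alpha> = \<alpha>"
    and hpaste_hidc: "is_cell A \<alpha> f v w g \<Longrightarrow> \<alpha> \<parallel> hidc A w = \<alpha>"
    and hpaste_assoc: "\<lbrakk>\<alpha> \<in> cells A; \<beta> \<in> cells A; \<gamma> \<in> cells A;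
          cright A \<alpha> = cleft A \<beta>; cright A \<beta> = cleft A \<gamma>\<rbrakk>
          \<Longrightarrow> (\<alpha> \<parallel> \<beta>) \<parallel> \<gamma> = \<alpha> \<parallel> (\<beta> \<parallel> \<gamma>)"
  \<comment> \<open>vertical pasting\<close>
    and vidc_cell: "is_hor A f X Y \<Longrightarrow> is_cell A (vidc A f) f (vid A X) (vid A Y) f"
    and vpaste_cell: "\<lbrakk>is_cell A \<alpha> f v w g; is_cell A \<beta> g v' w' h\<rbrakk>
          \<Longrightarrow> is_cell A (\<alpha> \<oslash> \<beta>) f (v' \<bullet> v) (w' \<bullet> w) h"
    and vidc_vpaste: "is_cell A \<alpha> f v w g \<Longrightarrow> vidc A f \<oslash> \<alpha> = \<alpha>"
    and vpaste_vidc: "is_cell A \<alpha> f v w g \<Longrightarrow> \<alpha> \<oslash> vidc A g = \<alpha>"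
  \<comment> \<open>functoriality of vertical pasting and identities\<close>
    and interchange: "\<lbrakk>\<alpha> \<in> cells A; \<beta> \<in> cells A; \<gamma> \<in> cells A; \<delta> \<in> cells A;
          cright A \<alpha> = cleft A \<beta>; cright A \<gamma> = cleft A \<delta>;
          cbot A \<alpha> = ctop A \<gamma>; cbot A \<beta> = ctop A \<delta>\<rbrakk>
          \<Longrightarrow> (\<alpha> \<parallel> \<beta>) \<oslash> (\<gamma> \<parallel> \<delta>) = (\<alpha> \<oslash> \<gamma>) \<parallel> (\<beta> \<oslash> \<delta>)"
    and hidc_vcomp: "\<lbrakk>is_ver A v X Y; is_ver A w Y Z\<rbrakk> \<Longrightarrow> hidc A (w \<bullet> v) = hidc A v \<oslash> hidc A w"
    and vidc_hcomp: "\<lbrakk>is_hor A f X Y; is_hor A g Y Z\<rbrakk> \<Longrightarrow> vidc A (g \<odot> f) = vidc A f \<parallel> vidc A g"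
    and vidc_hid: "X \<in> objs A \<Longrightarrow> vidc A (hid A X) = hidc A (vid A X)"
  \<comment> \<open>associativity isomorphisms\<close>
    and assoc_cell: "\<lbrakk>is_ver A v W X; is_ver A w X Y; is_ver A x Y Z\<rbrakk>
          \<Longrightarrow> globular A (assoc A x w v) ((x \<bullet> w) \<bullet> v) (x \<bullet> (w \<bullet> v))"
    and assoc_inv_cell: "\<lbrakk>is_ver A v W X; is_ver A w X Y; is_ver A x Y Z\<rbrakk>
          \<Longrightarrow> globular A (assoc_inv A x w v) (x \<bullet> (w \<bullet> v)) ((x \<bullet> w) \<bullet> v)"
    and assoc_assoc_inv: "\<lbrakk>is_ver A v W X; is_ver A w X Y; is_ver A x Y Z\<rbrakk>
          \<Longrightarrow> assoc A x w v \<parallel> assoc_inv A x w v = hidc A ((x \<bullet> w) \<bullet> v)"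
    and assoc_inv_assoc: "\<lbrakk>is_ver A v W X; is_ver A w X Y; is_ver A x Y Z\<rbrakk>
          \<Longrightarrow> assoc_inv A x w v \<parallel> assoc A x w v = hidc A (x \<bullet> (w \<bullet> v))"
    and assoc_natural: "\<lbrakk>is_cell A \<alpha> f v v' g; is_cell A \<beta> g w w' h; is_cell A \<gamma> h x x' k\<rbrakk>
          \<Longrightarrow> \<alpha> \<oslash> (\<beta> \<oslash> \<gamma>) \<parallel> assoc A x' w' v' = assoc A x w v \<parallel> (\<alpha> \<oslash> \<beta>) \<oslash> \<gamma>"
    and pentagon: "\<lbrakk>is_ver A v V W; is_ver A w W X; is_ver A x X Y; is_ver A y Y Z\<rbrakk>
          \<Longrightarrow> assoc A (y \<bullet> x) w v \<parallel> assoc A y x (w \<bullet> v)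
            = hidc A v \<oslash> assoc A y x w \<parallel> assoc A y (x \<bullet> w) v \<parallel> assoc A x w v \<oslash> hidc A y"
    and triangle: "\<lbrakk>is_ver A v X Y; is_ver A w Y Z\<rbrakk>
          \<Longrightarrow> assoc A w (vid A Y) v = hidc A (w \<bullet> v)"

section \<open>Companions\<close>

record ('o, 'h, 'v, 'c) dblcat_comp = "('o, 'h, 'v, 'c) dblcat" +
  companion :: "'h \<Rightarrow> 'v"
  cpsi :: "'h \<Rightarrow> 'c"
  cchi :: "'h \<Rightarrow> 'c"

definition is_companion ::
  "('o, 'h, 'v, 'c, 'x) dblcat_scheme \<Rightarrow> 'h \<Rightarrow> 'v \<Rightarrow> 'c \<Rightarrow> 'c \<Rightarrow> bool" where
  "is_companion A f u \<psi> \<chi> \<longleftrightarrow>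
     is_ver A u (hdom A f) (hcod A f) \<and>
     is_cell A \<psi> (hid A (hdom A f)) (vid A (hdom A f)) u f \<and>
     is_cell A \<chi> f u (vid A (hcod A f)) (hid A (hcod A f)) \<and>
     \<psi> \<parallel>\<^bsub>A\<^esub> \<chi> = vidc A f \<and>
     \<psi> \<oslash>\<^bsub>A\<^esub> \<chi> = hidc A u"

text \<open>The choice \<open>(1\<^sub>X)\<^sub>* = id\<^sub>X\<close> includes the binding cells, which are taken to be identities: without
  this the identity retrocells would not be neutral for composition.\<close>

locale chosen_companions =
  fixes A :: "('o, 'h, 'v, 'c, 'x) dblcat_comp_scheme" (structure)
  assumes companion: "f \<in> hors A \<Longrightarrow> is_companion A f (companion A f) (cpsi A f) (cchi A f)"
    and companion_hid: "X \<in> objs A \<Longrightarrow> companion A (hid A X) = vid A X"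
    and cpsi_hid: "X \<in> objs A \<Longrightarrow> cpsi A (hid A X) = hidc A (vid A X)"
    and cchi_hid: "X \<in> objs A \<Longrightarrow> cchi A (hid A X) = hidc A (vid A X)"

section \<open>Retrocells\<close>

record ('h, 'v, 'c) retrocell =
  rtop :: 'h
  rleft :: 'v
  rright :: 'v
  rbot :: 'h
  rcell :: 'c  \<comment> \<open>the globular cell \<open>rright \<bullet> (rtop)\<^sub>* \<Rightarrow> (rbot)\<^sub>* \<bullet> rleft\<close>\<close>

context
  fixes A :: "('o, 'h, 'v, 'c, 'x) dblcat_comp_scheme" (structure)
begin

text \<open>The canonical isomorphism \<open>(hf)\<^sub>* \<Rightarrow> h\<^sub>* \<bullet> f\<^sub>*\<close> and its inverse.\<close>

definition comp_iso :: "'h \<Rightarrow> 'h \<Rightarrow> 'c" where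
  "comp_iso h f = (cpsi A f \<oslash> (vidc A f \<parallel> cpsi A h)) \<oslash> cchi A (h \<odot> f)"

definition comp_iso_inv :: "'h \<Rightarrow> 'h \<Rightarrow> 'c" where
  "comp_iso_inv h f = cpsi A (h \<odot> f) \<oslash> ((cchi A f \<parallel> vidc A h) \<oslash> cchi A h)"

definition is_retrocell :: "('h, 'v, 'c) retrocell \<Rightarrow> bool" where
  "is_retrocell \<alpha> \<longleftrightarrow>
     rtop \<alpha> \<in> hors A \<and> rbot \<alpha> \<in> hors A \<and>
     is_ver A (rleft \<alpha>) (hdom A (rtop \<alpha>)) (hdom A (rbot \<alpha>)) \<and>
     is_ver A (rright \<alpha>) (hcod A (rtop \<alpha>)) (hcod A (rbot \<alpha>)) \<and>
     globular A (rcell \<alpha>) (rright \<alpha> \<bullet> companion A (rtop \<alpha>)) (companion A (rbot \<alpha>) \<bullet> rleft \<alpha>)"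

definition retro_id :: "'v \<Rightarrow> ('h, 'v, 'c) retrocell" where
  "retro_id v = \<lparr>rtop = hid A (vdom A v), rleft = v, rright = v, rbot = hid A (vcod A v),
                 rcell = hidc A v\<rparr>"

text \<open>The horizontal composite \<open>\<beta>\<alpha>\<close>, with the associativity isomorphisms written out.\<close>

definition retro_comp ::
  "('h, 'v, 'c) retrocell \<Rightarrow> ('h, 'v, 'c) retrocell \<Rightarrow> ('h, 'v, 'c) retrocell" where
  "retro_comp \<beta> \<alpha> =
     (let f = rtop \<alpha>; g = rbot \<alpha>; v = rleft \<alpha>; w = rright \<alpha>;
          h = rtop \<beta>; k = rbot \<beta>; x = rright \<beta>
      in \<lparr>rtop = h \<odot> f, rleft = v, rright = x, rbot = k \<odot> g,
          rcell = (comp_iso h f \<oslash> hidc A x)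
                \<parallel> assoc_inv A x (companion A h) (companion A f)
                \<parallel> (hidc A (companion A f) \<oslash> rcell \<beta>)
                \<parallel> assoc A (companion A k) w (companion A f)
                \<parallel> (rcell \<alpha> \<oslash> hidc A (companion A k))
                \<parallel> assoc_inv A (companion A k) (companion A g) v
                \<parallel> (hidc A v \<oslash> comp_iso_inv k g)\<rparr>)"

end

section \<open>Strong left homs\<close>

record ('o, 'h, 'v, 'c) dblcat_hom = "('o, 'h, 'v, 'c) dblcat_comp" +
  lhom :: "'v \<Rightarrow> 'v \<Rightarrow> 'v" (infix "\<setminus>\<index>" 75)
  lev :: "'v \<Rightarrow> 'v \<Rightarrow> 'c"

definition is_strong_left_hom ::
  "('o, 'h, 'v, 'c, 'x) dblcat_scheme \<Rightarrow> 'v \<Rightarrow> 'v \<Rightarrow> 'v \<Rightarrow> 'c \<Rightarrow> bool" where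
  "is_strong_left_hom A y z u \<epsilon> \<longleftrightarrow>
     is_ver A u (vdom A z) (vdom A y) \<and>
     globular A \<epsilon> (y \<bullet>\<^bsub>A\<^esub> u) z \<and>
     (\<forall>f x \<alpha>. is_hor A f (hdom A f) (vdom A z) \<and> is_ver A x (hdom A f) (vdom A y) \<and>
        is_cell A \<alpha> f (y \<bullet>\<^bsub>A\<^esub> x) z (hid A (vcod A z)) \<longrightarrow>
        (\<exists>!\<beta>. is_cell A \<beta> f x u (hid A (vdom A y)) \<and> \<beta> \<oslash>\<^bsub>A\<^esub> hidc A y \<parallel>\<^bsub>A\<^esub> \<epsilon> = \<alpha>))"

locale left_closed =
  fixes A :: "('o, 'h, 'v, 'c, 'x) dblcat_hom_scheme" (structure)
  assumes strong_left_hom: "\<lbrakk>y \<in> vers A; z \<in> vers A; vcod A y = vcod A z\<rbrakk>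
          \<Longrightarrow> is_strong_left_hom A y z (y \<setminus> z) (lev A y z)"

section \<open>The categories and the internal hom\<close>

text \<open>The category \<open>\<^bold>A\<^sub>1\<close> of vertical arrows and cells.\<close>

definition ver_cat :: "('o, 'h, 'v, 'c, 'x) dblcat_scheme \<Rightarrow> ('v, 'c) cat" where
  "ver_cat A = \<lparr>Obj = vers A, Arr = cells A, Dom = cleft A, Cod = cright A, Id = hidc A,
                Comp = (\<lambda>\<beta> \<alpha>. \<alpha> \<parallel>\<^bsub>A\<^esub> \<beta>)\<rparr>"

text \<open>Twisted cospans. The horizontal arrows \<open>a\<close>, \<open>b\<close>, \<open>c\<close> of a morphism \<open>(a, b, c, \<beta>, \<gamma>)\<close> are
  determined by the pair \<open>(\<beta>, \<gamma>)\<close>: they are the top of \<open>\<gamma>\<close>, the top of \<open>\<beta>\<close> and the common bottom.\<close>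

definition TC ::
  "('o, 'h, 'v, 'c, 'x) dblcat_comp_scheme \<Rightarrow> ('v \<times> 'v, ('h, 'v, 'c) retrocell \<times> 'c) cat" where
  "TC A = \<lparr>Obj = {(y, z). y \<in> vers A \<and> z \<in> vers A \<and> vcod A y = vcod A z},
           Arr = {(\<beta>, \<gamma>). is_retrocell A \<beta> \<and> \<gamma> \<in> cells A \<and> rbot \<beta> = cbot A \<gamma>},
           Dom = (\<lambda>(\<beta>, \<gamma>). (rleft \<beta>, cleft A \<gamma>)),
           Cod = (\<lambda>(\<beta>, \<gamma>). (rright \<beta>, cright A \<gamma>)),
           Id = (\<lambda>(y, z). (retro_id A y, hidc A z)),
           Comp = (\<lambda>(\<beta>', \<gamma>') (\<beta>, \<gamma>). (retro_comp A \<beta>' \<beta>, \<gamma> \<parallel>\<^bsub>A\<^esub> \<gamma>'))\<rparr>"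

text \<open>The cell \<open>\<beta> \<setminus> \<gamma>\<close>, with the associativity isomorphisms written out; the two sides of the defining
  equation go from \<open>(y' \<bullet> b\<^sub>*) \<bullet> (y \<setminus> z)\<close> to \<open>z'\<close>.\<close>

definition is_lhom_cell ::
  "('o, 'h, 'v, 'c, 'x) dblcat_hom_scheme \<Rightarrow> ('h, 'v, 'c) retrocell \<Rightarrow> 'c \<Rightarrow> 'c \<Rightarrow> bool" where
  "is_lhom_cell A \<beta> \<gamma> \<xi> \<longleftrightarrow>
     (let y = rleft \<beta>; y' = rright \<beta>; z = cleft A \<gamma>; z' = cright A \<gamma>;
          a = ctop A \<gamma>; b = rtop \<beta>; c = rbot \<beta>;
          u = y \<setminus>\<^bsub>A\<^esub> z; u' = y' \<setminus>\<^bsub>A\<^esub> z'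
      in is_cell A \<xi> a u u' b \<and>
         \<xi> \<oslash>\<^bsub>A\<^esub> (cchi A b \<oslash>\<^bsub>A\<^esub> hidc A y') \<parallel>\<^bsub>A\<^esub> lev A y' z'
         = (hidc A u \<oslash>\<^bsub>A\<^esub> rcell \<beta>)
           \<parallel>\<^bsub>A\<^esub> assoc A (companion A c) y u
           \<parallel>\<^bsub>A\<^esub> (lev A y z \<oslash>\<^bsub>A\<^esub> hidc A (companion A c))
           \<parallel>\<^bsub>A\<^esub> (\<gamma> \<oslash>\<^bsub>A\<^esub> cchi A c))"

definition lhom_cell ::
  "('o, 'h, 'v, 'c, 'x) dblcat_hom_scheme \<Rightarrow> ('h, 'v, 'c) retrocell \<Rightarrow> 'c \<Rightarrow> 'c" where
  "lhom_cell A \<beta> \<gamma> = (THE \<xi>. is_lhom_cell A \<beta> \<gamma> \<xi>)"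

end

theory Submission
  imports Defs
begin

text \<open>
  Why the theorem holds. The cell \<open>\<beta> \<setminus> \<gamma>\<close> is defined by an equation, and it is the only solution:
  pasting \<open>\<chi>\<^bsub>b\<^esub>\<close> below a cell is a bijection, with inverse given by \<open>\<psi>\<^bsub>b\<^esub>\<close>
  (\<open>companion_transpose\<close>), and the rest is the universal property of \<open>y' \<setminus> z'\<close>. So functoriality
  amounts to checking that identities and composites solve the right equations. For identities this
  is immediate. For composites, \<open>hom_equation_comp\<close> pastes the equation of the first morphism, whiskered
  by a companion, to that of the second; besides sliding cells past each other, this needs only that the
  canonical isomorphism \<open>(hf)\<^sub>* \<cong> h\<^sub>* \<bullet> f\<^sub>*\<close> is compatible with the binding cells \<open>\<chi>\<close>.

  That twisted cospans form a category is part of the claim, and the one law with content is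
  associativity of the composition of retrocells. It follows from the coherence of the isomorphisms
  \<open>(hf)\<^sub>* \<cong> h\<^sub>* \<bullet> f\<^sub>*\<close> for three factors (\<open>comp_iso_assoc\<close>, \<open>comp_iso_inv_assoc\<close>). Here too the binding
  cells do the work: a globular cell into a companion is determined by its composite with \<open>\<chi>\<close>
  (\<open>companion_cancel\<close>), and both sides of the coherence equation have the same such composite.

  Both calculations involve composites of four vertical arrows, where associativity isomorphisms would
  obscure the idea. They are therefore carried out in a strict double category and then transported. Every
  double category has a strictification, whose vertical arrows are paths and whose cells are the
  cells between the composites of the paths. The isomorphisms \<open>|p @ q| \<cong> |q| \<bullet> |p|\<close> that define its vertical
  pasting satisfy an associativity law (\<open>join_assoc\<close>), where the pentagon is used. All bracketings in
  the definitions of retrocell composition and of \<open>\<beta> \<setminus> \<gamma>\<close> are then accounted for: up to these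
  isomorphisms the formulas in the double category are those in its strictification, with every
  vertical arrow read as a path of length one.
\<close>

section \<open>The calculus of cells\<close>

lemma retro_comp_simps [simp]:
  "rtop (retro_comp A \<beta> \<alpha>) = rtop \<beta> \<odot>\<^bsub>A\<^esub> rtop \<alpha>" "rbot (retro_comp A \<beta> \<alpha>) = rbot \<beta> \<odot>\<^bsub>A\<^esub> rbot \<alpha>"
  "rleft (retro_comp A \<beta> \<alpha>) = rleft \<alpha>" "rright (retro_comp A \<beta> \<alpha>) = rright \<beta>"
  by (simp_all add: retro_comp_def Let_def)

context double_category
begin

text \<open>The axioms are recast as conditional rewrite rules in terms of carriers and boundary maps, so that
  the simplifier computes the boundary of any pasting from those of its parts. Most pasting diagrams
  below are typed in this way.\<close>

lemma hid_simps [simp]: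
  assumes "X \<in> objs A"
  shows "hid A X \<in> hors A" "hdom A (hid A X) = X" "hcod A (hid A X) = X"
  using hid_hor[OF assms] by (simp_all add: is_hor_def)

lemma hcomp_simps [simp]:
  assumes "f \<in> hors A" "g \<in> hors A" "hcod A f = hdom A g"
  shows "g \<odot> f \<in> hors A" "hdom A (g \<odot> f) = hdom A f" "hcod A (g \<odot> f) = hcod A g"
  using hcomp_hor[of f "hdom A f" "hcod A f" g "hcod A g"] assms by (simp_all add: is_hor_def)

lemma hcomp_hid' [simp]: "f \<in> hors A \<Longrightarrow> hdom A f = X \<Longrightarrow> f \<odot> hid A X = f"
  using hcomp_hid by (auto simp: is_hor_def)

lemma hid_hcomp' [simp]: "f \<in> hors A \<Longrightarrow> hcod A f = X \<Longrightarrow> hid A X \<odot> f = f"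
  using hid_hcomp by (auto simp: is_hor_def)

lemma hcomp_assoc' [simp]:
  "f \<in> hors A \<Longrightarrow> g \<in> hors A \<Longrightarrow> h \<in> hors A \<Longrightarrow> hcod A f = hdom A g \<Longrightarrow> hcod A g = hdom A h
    \<Longrightarrow> (h \<odot> g) \<odot> f = h \<odot> (g \<odot> f)"
  using hcomp_assoc by (simp add: is_hor_def)

lemma vid_simps [simp]:
  assumes "X \<in> objs A"
  shows "vid A X \<in> vers A" "vdom A (vid A X) = X" "vcod A (vid A X) = X"
  using vid_ver[OF assms] by (simp_all add: is_ver_def)

lemma vcomp_simps [simp]:
  assumes "v \<in> vers A" "w \<in> vers A" "vcod A v = vdom A w"
  shows "w \<bullet> v \<in> vers A" "vdom A (w \<bullet> v) = vdom A v" "vcod A (w \<bullet> v) = vcod A w"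
  using vcomp_ver[of v "vdom A v" "vcod A v" w "vcod A w"] assms by (simp_all add: is_ver_def)

lemma vcomp_vid' [simp]: "v \<in> vers A \<Longrightarrow> vdom A v = X \<Longrightarrow> v \<bullet> vid A X = v"
  using vcomp_vid by (auto simp: is_ver_def)

lemma vid_vcomp' [simp]: "v \<in> vers A \<Longrightarrow> vcod A v = X \<Longrightarrow> vid A X \<bullet> v = v"
  using vid_vcomp by (auto simp: is_ver_def)

declare hdom_obj [simp] hcod_obj [simp] vdom_obj [simp] vcod_obj [simp]
  cleft_ver [simp] cright_ver [simp]

lemma cell_simps [simp]:
  assumes "\<alpha> \<in> cells A"
  shows "ctop A \<alpha> \<in> hors A" "cbot A \<alpha> \<in> hors A"
    "hdom A (ctop A \<alpha>) = vdom A (cleft A \<alpha>)" "hcod A (ctop A \<alpha>) = vdom A (cright A \<alpha>)"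
    "hdom A (cbot A \<alpha>) = vcod A (cleft A \<alpha>)" "hcod A (cbot A \<alpha>) = vcod A (cright A \<alpha>)"
  using ctop_hor[OF assms] cbot_hor[OF assms] by (simp_all add: is_hor_def)

lemma hidc_simps [simp]:
  assumes "v \<in> vers A"
  shows "hidc A v \<in> cells A" "ctop A (hidc A v) = hid A (vdom A v)" "cleft A (hidc A v) = v"
    "cright A (hidc A v) = v" "cbot A (hidc A v) = hid A (vcod A v)"
  using hidc_cell[of v "vdom A v" "vcod A v"] assms by (simp_all add: is_cell_def is_ver_def)

lemma vidc_simps [simp]:
  assumes "f \<in> hors A"
  shows "vidc A f \<in> cells A" "ctop A (vidc A f) = f" "cleft A (vidc A f) = vid A (hdom A f)"
    "cright A (vidc A f) = vid A (hcod A f)" "cbot A (vidc A f) = f"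
  using vidc_cell[of f "hdom A f" "hcod A f"] assms by (simp_all add: is_cell_def is_hor_def)

lemma hpaste_simps [simp]:
  assumes "\<alpha> \<in> cells A" "\<beta> \<in> cells A" "cright A \<alpha> = cleft A \<beta>"
  shows "\<alpha> \<parallel> \<beta> \<in> cells A" "ctop A (\<alpha> \<parallel> \<beta>) = ctop A \<beta> \<odot> ctop A \<alpha>"
    "cleft A (\<alpha> \<parallel> \<beta>) = cleft A \<alpha>" "cright A (\<alpha> \<parallel> \<beta>) = cright A \<beta>"
    "cbot A (\<alpha> \<parallel> \<beta>) = cbot A \<beta> \<odot> cbot A \<alpha>"
  using hpaste_cell[of \<alpha> _ _ "cleft A \<beta>" _ \<beta>] assms by (simp_all add: is_cell_def)

lemma vpaste_simps [simp]:
  assumes "\<alpha> \<in> cells A" "\<beta> \<in> cells A" "cbot A \<alpha> = ctop A \<beta>"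
  shows "\<alpha> \<oslash> \<beta> \<in> cells A" "ctop A (\<alpha> \<oslash> \<beta>) = ctop A \<alpha>"
    "cleft A (\<alpha> \<oslash> \<beta>) = cleft A \<beta> \<bullet> cleft A \<alpha>" "cright A (\<alpha> \<oslash> \<beta>) = cright A \<beta> \<bullet> cright A \<alpha>"
    "cbot A (\<alpha> \<oslash> \<beta>) = cbot A \<beta>"
  using vpaste_cell[of \<alpha> _ _ _ "ctop A \<beta>" \<beta>] assms by (simp_all add: is_cell_def)

lemma matching_corners:
  assumes "\<alpha> \<in> cells A" "\<beta> \<in> cells A" "cbot A \<alpha> = ctop A \<beta>"
  shows "vcod A (cleft A \<alpha>) = vdom A (cleft A \<beta>)" "vcod A (cright A \<alpha>) = vdom A (cright A \<beta>)"
  using cell_simps[OF assms(1)] cell_simps[OF assms(2)] assms(3) by simp_all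

lemma hidc_hpaste' [simp]: "\<alpha> \<in> cells A \<Longrightarrow> cleft A \<alpha> = v \<Longrightarrow> hidc A v \<parallel> \<alpha> = \<alpha>"
  using hidc_hpaste by (auto simp: is_cell_def)

lemma hpaste_hidc' [simp]: "\<alpha> \<in> cells A \<Longrightarrow> cright A \<alpha> = v \<Longrightarrow> \<alpha> \<parallel> hidc A v = \<alpha>"
  using hpaste_hidc by (auto simp: is_cell_def)

lemma vidc_vpaste' [simp]: "\<alpha> \<in> cells A \<Longrightarrow> ctop A \<alpha> = f \<Longrightarrow> vidc A f \<oslash> \<alpha> = \<alpha>"
  using vidc_vpaste by (auto simp: is_cell_def)

lemma vpaste_vidc' [simp]: "\<alpha> \<in> cells A \<Longrightarrow> cbot A \<alpha> = f \<Longrightarrow> \<alpha> \<oslash> vidc A f = \<alpha>"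
  using vpaste_vidc by (auto simp: is_cell_def)

lemma hidc_vid_vpaste [simp]:
  "\<alpha> \<in> cells A \<Longrightarrow> X \<in> objs A \<Longrightarrow> ctop A \<alpha> = hid A X \<Longrightarrow> hidc A (vid A X) \<oslash> \<alpha> = \<alpha>"
  using vidc_hid[of X] vidc_vpaste' by metis

lemma vpaste_hidc_vid [simp]:
  "\<alpha> \<in> cells A \<Longrightarrow> X \<in> objs A \<Longrightarrow> cbot A \<alpha> = hid A X \<Longrightarrow> \<alpha> \<oslash> hidc A (vid A X) = \<alpha>"
  using vidc_hid[of X] vpaste_vidc' by metis

lemma hidc_vpaste_hidc [simp]:
  "v \<in> vers A \<Longrightarrow> w \<in> vers A \<Longrightarrow> vcod A v = vdom A w \<Longrightarrow> hidc A v \<oslash> hidc A w = hidc A (w \<bullet> v)"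
  using hidc_vcomp by (simp add: is_ver_def)

lemma vidc_hpaste_vidc [simp]:
  "f \<in> hors A \<Longrightarrow> g \<in> hors A \<Longrightarrow> hcod A f = hdom A g \<Longrightarrow> vidc A f \<parallel> vidc A g = vidc A (g \<odot> f)"
  using vidc_hcomp by (simp add: is_hor_def)

lemma globularD:
  assumes "globular A \<alpha> v w"
  shows "\<alpha> \<in> cells A" "cleft A \<alpha> = v" "cright A \<alpha> = w"
    "ctop A \<alpha> = hid A (vdom A v)" "cbot A \<alpha> = hid A (vcod A v)"
  using assms by (simp_all add: globular_def is_cell_def)

lemma globular_parallel:
  assumes "globular A \<alpha> v w"
  shows "v \<in> vers A" "w \<in> vers A" "vdom A w = vdom A v" "vcod A w = vcod A v"
proof -
  note g = globularD[OF assms]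
  show "v \<in> vers A" "w \<in> vers A" using cleft_ver[OF g(1)] cright_ver[OF g(1)] g by auto
  then show "vdom A w = vdom A v" "vcod A w = vcod A v"
    using cell_simps(4,6)[OF g(1)] g by auto
qed

lemma globularI:
  "\<alpha> \<in> cells A \<Longrightarrow> cleft A \<alpha> = v \<Longrightarrow> cright A \<alpha> = w \<Longrightarrow> ctop A \<alpha> = hid A (vdom A v)
    \<Longrightarrow> cbot A \<alpha> = hid A (vcod A v) \<Longrightarrow> globular A \<alpha> v w"
  by (simp add: globular_def is_cell_def)

text \<open>Cells that meet in an identity arrow can be slid past each other: together the next two lemmas
  say that they may be pasted side by side in either order.\<close>

lemma vpaste_left_first:
  assumes "\<alpha> \<in> cells A" "\<beta> \<in> cells A" "cbot A \<alpha> = hid A X" "ctop A \<beta> = hid A X" "X \<in> objs A"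
  shows "\<alpha> \<oslash> \<beta> = (\<alpha> \<oslash> hidc A (cleft A \<beta>)) \<parallel> (hidc A (cright A \<alpha>) \<oslash> \<beta>)"
proof -
  have c: "vcod A (cleft A \<alpha>) = X" "vcod A (cright A \<alpha>) = X" "vdom A (cleft A \<beta>) = X"
      "vdom A (cright A \<beta>) = X"
    using cell_simps[OF assms(1)] cell_simps[OF assms(2)] assms by auto
  then show ?thesis
    using interchange[of \<alpha> "hidc A (cright A \<alpha>)" "hidc A (cleft A \<beta>)" \<beta>] assms by simp
qed

lemma vpaste_right_first:
  assumes "\<alpha> \<in> cells A" "\<beta> \<in> cells A" "cbot A \<alpha> = hid A X" "ctop A \<beta> = hid A X" "X \<in> objs A"
  shows "\<alpha> \<oslash> \<beta> = (hidc A (cleft A \<alpha>) \<oslash> \<beta>) \<parallel> (\<alpha> \<oslash> hidc A (cright A \<beta>))"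
proof -
  have c: "vcod A (cleft A \<alpha>) = X" "vcod A (cright A \<alpha>) = X" "vdom A (cleft A \<beta>) = X"
      "vdom A (cright A \<beta>) = X"
    using cell_simps[OF assms(1)] cell_simps[OF assms(2)] assms by auto
  then show ?thesis
    using interchange[of "hidc A (cleft A \<alpha>)" \<alpha> \<beta> "hidc A (cright A \<beta>)"] assms by simp
qed

lemma whisker_distribs:
  assumes "\<kappa> \<in> cells A" "\<mu> \<in> cells A" "cright A \<kappa> = cleft A \<mu>" "v \<in> vers A"
  shows "cbot A \<kappa> = hid A (vdom A v) \<Longrightarrow> cbot A \<mu> = hid A (vdom A v) \<Longrightarrow>
      (\<kappa> \<parallel> \<mu>) \<oslash> hidc A v = (\<kappa> \<oslash> hidc A v) \<parallel> (\<mu> \<oslash> hidc A v)"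
    "ctop A \<kappa> = hid A (vcod A v) \<Longrightarrow> ctop A \<mu> = hid A (vcod A v) \<Longrightarrow>
      hidc A v \<oslash> (\<kappa> \<parallel> \<mu>) = (hidc A v \<oslash> \<kappa>) \<parallel> (hidc A v \<oslash> \<mu>)"
  using interchange[of \<kappa> \<mu> "hidc A v" "hidc A v"] interchange[of "hidc A v" "hidc A v" \<kappa> \<mu>] assms
  by simp_all

declare hpaste_assoc [simp]

lemma assoc_simps [simp]:
  assumes "v \<in> vers A" "w \<in> vers A" "x \<in> vers A" "vcod A v = vdom A w" "vcod A w = vdom A x"
  shows "assoc A x w v \<in> cells A" "ctop A (assoc A x w v) = hid A (vdom A v)"
    "cleft A (assoc A x w v) = (x \<bullet> w) \<bullet> v" "cright A (assoc A x w v) = x \<bullet> (w \<bullet> v)"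
    "cbot A (assoc A x w v) = hid A (vcod A x)"
    "assoc_inv A x w v \<in> cells A" "ctop A (assoc_inv A x w v) = hid A (vdom A v)"
    "cleft A (assoc_inv A x w v) = x \<bullet> (w \<bullet> v)" "cright A (assoc_inv A x w v) = (x \<bullet> w) \<bullet> v"
    "cbot A (assoc_inv A x w v) = hid A (vcod A x)"
    "assoc A x w v \<parallel> assoc_inv A x w v = hidc A ((x \<bullet> w) \<bullet> v)"
    "assoc_inv A x w v \<parallel> assoc A x w v = hidc A (x \<bullet> (w \<bullet> v))"
  using assms assoc_cell[of v "vdom A v" "vcod A v" w "vcod A w" x "vcod A x"]
    assoc_inv_cell[of v "vdom A v" "vcod A v" w "vcod A w" x "vcod A x"]
    assoc_assoc_inv[of v "vdom A v" "vcod A v" w "vcod A w" x "vcod A x"]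
    assoc_inv_assoc[of v "vdom A v" "vcod A v" w "vcod A w" x "vcod A x"]
  by (auto simp: globular_def is_cell_def is_ver_def)

lemma assoc_natural':
  assumes "\<alpha> \<in> cells A" "\<beta> \<in> cells A" "\<gamma> \<in> cells A" "cbot A \<alpha> = ctop A \<beta>" "cbot A \<beta> = ctop A \<gamma>"
  shows "\<alpha> \<oslash> (\<beta> \<oslash> \<gamma>) \<parallel> assoc A (cright A \<gamma>) (cright A \<beta>) (cright A \<alpha>)
    = assoc A (cleft A \<gamma>) (cleft A \<beta>) (cleft A \<alpha>) \<parallel> (\<alpha> \<oslash> \<beta>) \<oslash> \<gamma>"
  using assoc_natural[of \<alpha> _ _ _ _ \<beta> _ _ _ \<gamma>] assms by (simp add: is_cell_def)

lemma companionD: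
  assumes "is_companion A f u \<psi> \<chi>" "f \<in> hors A"
  shows "u \<in> vers A" "vdom A u = hdom A f" "vcod A u = hcod A f"
    "\<psi> \<in> cells A" "ctop A \<psi> = hid A (hdom A f)" "cleft A \<psi> = vid A (hdom A f)"
    "cright A \<psi> = u" "cbot A \<psi> = f"
    "\<chi> \<in> cells A" "ctop A \<chi> = f" "cleft A \<chi> = u"
    "cright A \<chi> = vid A (hcod A f)" "cbot A \<chi> = hid A (hcod A f)"
    "\<psi> \<parallel> \<chi> = vidc A f" "\<psi> \<oslash> \<chi> = hidc A u"
  using assms by (auto simp: is_companion_def is_cell_def is_ver_def)

text \<open>The triangle axiom concerns an identity in the middle. With an identity in an outer place, the
  pentagon that has two adjacent identities shows that the associativity isomorphism is idempotent; as
  it is invertible, it is an identity.\<close>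

lemma assoc_idem:
  assumes "v \<in> vers A" "w \<in> vers A" "x \<in> vers A" "vcod A v = vdom A w" "vcod A w = vdom A x"
    and idem: "assoc A x w v \<parallel> assoc A x w v = assoc A x w v" and eq: "(x \<bullet> w) \<bullet> v = x \<bullet> (w \<bullet> v)"
  shows "assoc A x w v = hidc A (x \<bullet> (w \<bullet> v))"
proof -
  let ?a = "assoc A x w v" and ?b = "assoc_inv A x w v"
  have "?a = ?a \<parallel> (?a \<parallel> ?b)" using assms by simp
  also have "\<dots> = (?a \<parallel> ?a) \<parallel> ?b" using assms by (intro hpaste_assoc[symmetric]) simp_all
  also have "\<dots> = ?a \<parallel> ?b" by (simp only: idem)
  finally show ?thesis using assms by simp
qed

lemma assoc_vid_mid [simp]:
  assumes "v \<in> vers A" "w \<in> vers A" "vcod A v = vdom A w" "vcod A v = X"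
  shows "assoc A w (vid A X) v = hidc A (w \<bullet> v)"
  using triangle[of v "vdom A v" X w "vcod A w"] assms by (simp add: is_ver_def)

lemma assoc_vid_left [simp]:
  assumes "v \<in> vers A" "w \<in> vers A" "vcod A v = vdom A w" "vcod A w = X"
  shows "assoc A (vid A X) w v = hidc A (w \<bullet> v)"
proof -
  have X: "X \<in> objs A" using assms by auto
  have "assoc A (vid A X) w v \<parallel> assoc A (vid A X) w v = assoc A (vid A X) w v"
    using pentagon[of v "vdom A v" "vcod A v" w X "vid A X" X "vid A X" X] assms X
    by (simp add: is_ver_def)
  then show ?thesis using assoc_idem[of v w "vid A X"] assms X by simp
qed

lemma assoc_vid_right [simp]:
  assumes "v \<in> vers A" "w \<in> vers A" "vcod A v = vdom A w" "vdom A v = X"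
  shows "assoc A w v (vid A X) = hidc A (w \<bullet> v)"
proof -
  have X: "X \<in> objs A" using assms by auto
  have "assoc A w v (vid A X) \<parallel> assoc A w v (vid A X) = assoc A w v (vid A X)"
    using pentagon[of "vid A X" X X "vid A X" X v "vcod A v" w "vcod A w"] assms X
    by (simp add: is_ver_def)
  then show ?thesis using assoc_idem[of "vid A X" v w] assms X by simp
qed

lemma assoc_inv_id:
  assumes "v \<in> vers A" "w \<in> vers A" "x \<in> vers A" "vcod A v = vdom A w" "vcod A w = vdom A x"
    and a: "assoc A x w v = hidc A (x \<bullet> (w \<bullet> v))"
  shows "assoc_inv A x w v = hidc A (x \<bullet> (w \<bullet> v))"
proof -
  have "(x \<bullet> w) \<bullet> v = x \<bullet> (w \<bullet> v)"
    using assoc_simps(3)[OF assms(1-5)] assms(1-5) unfolding a by simp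
  then show ?thesis using assoc_simps(12)[OF assms(1-5)] assms(1-5) unfolding a by simp
qed

lemma assoc_inv_vid [simp]:
  assumes "v \<in> vers A" "w \<in> vers A" "vcod A v = vdom A w"
  shows "vcod A v = X \<Longrightarrow> assoc_inv A w (vid A X) v = hidc A (w \<bullet> v)"
    "vcod A w = X \<Longrightarrow> assoc_inv A (vid A X) w v = hidc A (w \<bullet> v)"
    "vdom A v = X \<Longrightarrow> assoc_inv A w v (vid A X) = hidc A (w \<bullet> v)"
  using assms assoc_inv_id[of v "vid A X" w] assoc_inv_id[of v w "vid A X"]
    assoc_inv_id[of "vid A X" v w] by auto

end

text \<open>Companions are chosen here without any normalization on identity arrows. The strictification
  satisfies this weaker requirement only: its chosen companion of an identity is a path of length one.\<close>

locale companion_double_category = double_category A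
  for A :: "('o, 'h, 'v, 'c, 'x) dblcat_comp_scheme" (structure) +
  assumes has_companion: "f \<in> hors A \<Longrightarrow> is_companion A f (companion A f) (cpsi A f) (cchi A f)"
begin

lemmas companion_simps [simp] = companionD[OF has_companion]

lemma retrocellD:
  assumes "is_retrocell A \<alpha>"
  shows "rtop \<alpha> \<in> hors A" "rbot \<alpha> \<in> hors A" "rleft \<alpha> \<in> vers A" "rright \<alpha> \<in> vers A"
    "vdom A (rleft \<alpha>) = hdom A (rtop \<alpha>)" "vcod A (rleft \<alpha>) = hdom A (rbot \<alpha>)"
    "vdom A (rright \<alpha>) = hcod A (rtop \<alpha>)" "vcod A (rright \<alpha>) = hcod A (rbot \<alpha>)"
    "rcell \<alpha> \<in> cells A" "ctop A (rcell \<alpha>) = hid A (hdom A (rtop \<alpha>))"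
    "cleft A (rcell \<alpha>) = rright \<alpha> \<bullet> companion A (rtop \<alpha>)"
    "cright A (rcell \<alpha>) = companion A (rbot \<alpha>) \<bullet> rleft \<alpha>"
    "cbot A (rcell \<alpha>) = hid A (hcod A (rbot \<alpha>))"
proof -
  show a: "rtop \<alpha> \<in> hors A" "rbot \<alpha> \<in> hors A" "rleft \<alpha> \<in> vers A" "rright \<alpha> \<in> vers A"
    "vdom A (rleft \<alpha>) = hdom A (rtop \<alpha>)" "vcod A (rleft \<alpha>) = hdom A (rbot \<alpha>)"
    "vdom A (rright \<alpha>) = hcod A (rtop \<alpha>)" "vcod A (rright \<alpha>) = hcod A (rbot \<alpha>)"
    using assms by (auto simp: is_retrocell_def is_ver_def)
  have "globular A (rcell \<alpha>) (rright \<alpha> \<bullet> companion A (rtop \<alpha>)) (companion A (rbot \<alpha>) \<bullet> rleft \<alpha>)"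
    using assms by (simp add: is_retrocell_def)
  then show "rcell \<alpha> \<in> cells A" "ctop A (rcell \<alpha>) = hid A (hdom A (rtop \<alpha>))"
    "cleft A (rcell \<alpha>) = rright \<alpha> \<bullet> companion A (rtop \<alpha>)"
    "cright A (rcell \<alpha>) = companion A (rbot \<alpha>) \<bullet> rleft \<alpha>"
    "cbot A (rcell \<alpha>) = hid A (hcod A (rbot \<alpha>))"
    using a by (auto simp: globular_def is_cell_def)
qed

lemma composable_retrocells:
  assumes "is_retrocell A \<alpha>" "is_retrocell A \<beta>" "rright \<alpha> = rleft \<beta>"
  shows "hcod A (rtop \<alpha>) = hdom A (rtop \<beta>)" "hcod A (rbot \<alpha>) = hdom A (rbot \<beta>)"
  using retrocellD(7,8)[OF assms(1)] retrocellD(5,6)[OF assms(2)] assms(3) by auto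

lemma comp_iso_cell [simp]:
  assumes "f \<in> hors A" "h \<in> hors A" "hcod A f = hdom A h"
  shows "comp_iso A h f \<in> cells A" "ctop A (comp_iso A h f) = hid A (hdom A f)"
    "cbot A (comp_iso A h f) = hid A (hcod A h)" "cleft A (comp_iso A h f) = companion A (h \<odot> f)"
    "cright A (comp_iso A h f) = companion A h \<bullet> companion A f"
    "comp_iso_inv A h f \<in> cells A" "ctop A (comp_iso_inv A h f) = hid A (hdom A f)"
    "cbot A (comp_iso_inv A h f) = hid A (hcod A h)"
    "cleft A (comp_iso_inv A h f) = companion A h \<bullet> companion A f"
    "cright A (comp_iso_inv A h f) = companion A (h \<odot> f)"
  using assms by (simp_all add: comp_iso_def comp_iso_inv_def)

lemma retro_comp_is_retrocell:
  assumes "is_retrocell A \<alpha>" "is_retrocell A \<beta>" "rright \<alpha> = rleft \<beta>"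
  shows "is_retrocell A (retro_comp A \<beta> \<alpha>)"
proof -
  note [simp] = retrocellD[OF assms(1), unfolded assms(3)] retrocellD[OF assms(2)] assms(3)
    composable_retrocells[OF assms]
  have "globular A (rcell (retro_comp A \<beta> \<alpha>)) (rright \<beta> \<bullet> companion A (rtop \<beta> \<odot> rtop \<alpha>))
     (companion A (rbot \<beta> \<odot> rbot \<alpha>) \<bullet> rleft \<alpha>)"
    by (auto intro!: globularI simp: retro_comp_def Let_def)
  then show ?thesis
    by (simp add: is_retrocell_def is_ver_def)
qed

end

section \<open>Strict double categories\<close>

text \<open>Strictness is expressed by equations on carriers, and the associativity isomorphisms are required
  to be identities so that the definitions of the composition of retrocells and of its ingredients apply
  unchanged.\<close>

locale strict_double_category = double_category A
  for A :: "('o, 'h, 'v, 'c, 'x) dblcat_scheme" (structure) +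
  assumes vcomp_assoc: "\<lbrakk>v \<in> vers A; w \<in> vers A; x \<in> vers A; vcod A v = vdom A w; vcod A w = vdom A x\<rbrakk>
      \<Longrightarrow> (x \<bullet> w) \<bullet> v = x \<bullet> (w \<bullet> v)"
    and vpaste_assoc: "\<lbrakk>\<alpha> \<in> cells A; \<beta> \<in> cells A; \<gamma> \<in> cells A; cbot A \<alpha> = ctop A \<beta>; cbot A \<beta> = ctop A \<gamma>\<rbrakk>
      \<Longrightarrow> (\<alpha> \<oslash> \<beta>) \<oslash> \<gamma> = \<alpha> \<oslash> (\<beta> \<oslash> \<gamma>)"
    and assoc_strict: "\<lbrakk>v \<in> vers A; w \<in> vers A; x \<in> vers A; vcod A v = vdom A w; vcod A w = vdom A x\<rbrakk>
      \<Longrightarrow> assoc A x w v = hidc A (x \<bullet> (w \<bullet> v))"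
begin

lemma assoc_inv_strict:
  "\<lbrakk>v \<in> vers A; w \<in> vers A; x \<in> vers A; vcod A v = vdom A w; vcod A w = vdom A x\<rbrakk>
    \<Longrightarrow> assoc_inv A x w v = hidc A (x \<bullet> (w \<bullet> v))"
  using assoc_strict by (intro assoc_inv_id)

declare vcomp_assoc [simp] assoc_strict [simp] assoc_inv_strict [simp] vpaste_assoc [simp]

lemma hidc_hidc_vpaste [simp]:
  assumes "v \<in> vers A" "w \<in> vers A" "vcod A v = vdom A w" "\<gamma> \<in> cells A" "ctop A \<gamma> = hid A (vcod A w)"
  shows "hidc A v \<oslash> (hidc A w \<oslash> \<gamma>) = hidc A (w \<bullet> v) \<oslash> \<gamma>"
  using vpaste_assoc[of "hidc A v" "hidc A w" \<gamma>] assms by simp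

text \<open>Companions compose. For the vertical triangle identity, the two middle binding cells \<open>\<psi>'\<close> and \<open>\<chi>\<close>
  are adjacent to identities only, so they can be slid into the order \<open>\<chi>\<close>, \<open>\<psi>'\<close>, after which the
  triangle identities of the two factors apply.\<close>

lemma companion_comp:
  assumes c: "is_companion A f u \<psi> \<chi>" "is_companion A h t \<psi>' \<chi>'"
    and fh: "f \<in> hors A" "h \<in> hors A" "hcod A f = hdom A h"
  shows "is_companion A (h \<odot> f) (t \<bullet> u) (\<psi> \<oslash> (vidc A f \<parallel> \<psi>')) ((\<chi> \<parallel> vidc A h) \<oslash> \<chi>')"
proof -
  note [simp] = fh companionD[OF c(1) fh(1)] companionD[OF c(2) fh(2)]
  have 1: "(\<psi> \<oslash> (vidc A f \<parallel> \<psi>')) \<parallel> ((\<chi> \<parallel> vidc A h) \<oslash> \<chi>') = vidc A (h \<odot> f)"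
  proof -
    have "(\<psi> \<oslash> (vidc A f \<parallel> \<psi>')) \<parallel> ((\<chi> \<parallel> vidc A h) \<oslash> \<chi>')
        = (\<psi> \<parallel> (\<chi> \<parallel> vidc A h)) \<oslash> ((vidc A f \<parallel> \<psi>') \<parallel> \<chi>')"
      by (rule interchange[symmetric]) simp_all
    also have "\<psi> \<parallel> (\<chi> \<parallel> vidc A h) = vidc A (h \<odot> f)"
      using hpaste_assoc[of \<psi> \<chi> "vidc A h", symmetric] by simp
    finally show ?thesis by simp
  qed
  have "(vidc A f \<parallel> \<psi>') \<oslash> (\<chi> \<parallel> vidc A h) = (vidc A f \<oslash> \<chi>) \<parallel> (\<psi>' \<oslash> vidc A h)"
    by (rule interchange) simp_all
  also have "\<dots> = \<chi> \<oslash> \<psi>'"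
    using vpaste_left_first[of \<chi> \<psi>' "hdom A h"] by simp
  finally have m: "(vidc A f \<parallel> \<psi>') \<oslash> (\<chi> \<parallel> vidc A h) = \<chi> \<oslash> \<psi>'" .
  have "(\<psi> \<oslash> (vidc A f \<parallel> \<psi>')) \<oslash> ((\<chi> \<parallel> vidc A h) \<oslash> \<chi>')
      = \<psi> \<oslash> (((vidc A f \<parallel> \<psi>') \<oslash> (\<chi> \<parallel> vidc A h)) \<oslash> \<chi>')"
    by simp
  \<comment> \<open>The triangle identities are withheld from the simplifier, so that both sides reassociate to
    the same composite.\<close>
  also have "\<dots> = (\<psi> \<oslash> \<chi>) \<oslash> (\<psi>' \<oslash> \<chi>')"
    unfolding m by (simp del: companionD[OF c(1) fh(1)] companionD[OF c(2) fh(2)]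
      add: companionD(1-14)[OF c(1) fh(1)] companionD(1-14)[OF c(2) fh(2)])
  also have "\<dots> = hidc A (t \<bullet> u)" by simp
  finally have 2: "(\<psi> \<oslash> (vidc A f \<parallel> \<psi>')) \<oslash> ((\<chi> \<parallel> vidc A h) \<oslash> \<chi>') = hidc A (t \<bullet> u)" .
  show ?thesis unfolding is_companion_def using 1 2 by (simp add: is_cell_def is_ver_def)
qed

text \<open>Two companions of the same arrow are compared by \<open>\<psi>' \<oslash> \<chi>\<close>; the canonical isomorphism
  \<open>(hf)\<^sub>* \<cong> h\<^sub>* \<bullet> f\<^sub>*\<close> and its inverse are comparisons with the composite companion. The comparison
  carries one binding cell \<open>\<chi>\<close> to the other.\<close>

lemma comparison_chi:
  assumes c: "is_companion A f u \<psi> \<chi>" "is_companion A f u' \<psi>' \<chi>'" and f: "f \<in> hors A"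
  shows "(\<psi>' \<oslash> \<chi>) \<parallel> \<chi>' = \<chi>"
proof -
  note [simp] = f companionD[OF c(1) f] companionD[OF c(2) f]
  have "(\<psi>' \<oslash> \<chi>) \<parallel> (\<chi>' \<oslash> hidc A (vid A (hcod A f))) = (\<psi>' \<parallel> \<chi>') \<oslash> (\<chi> \<parallel> hidc A (vid A (hcod A f)))"
    by (rule interchange[symmetric]) simp_all
  then show ?thesis by simp
qed

text \<open>A globular cell \<open>\<kappa>\<close> into a companion is recovered from \<open>\<kappa> \<parallel> \<chi>\<close> by pasting \<open>\<psi>\<close> on top. Hence
  equations between comparisons can be checked after composition with \<open>\<chi>\<close>.\<close>

lemma companion_cancel:
  assumes c: "is_companion A f u \<psi> \<chi>" and f: "f \<in> hors A"
    and g: "globular A \<kappa> t u" "globular A \<kappa>' t u" and eq: "\<kappa> \<parallel> \<chi> = \<kappa>' \<parallel> \<chi>"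
  shows "\<kappa> = \<kappa>'"
proof -
  note [simp] = f companionD[OF c(1) f]
  have "\<kappa> = \<psi> \<oslash> (\<kappa> \<parallel> \<chi>)" if g: "globular A \<kappa> t u" for \<kappa>
  proof -
    note [simp] = globularD[OF g] globular_parallel(1)[OF g]
      globular_parallel(3,4)[OF g, symmetric, simplified]
    have "(hidc A (vid A (hdom A f)) \<parallel> \<psi>) \<oslash> (\<kappa> \<parallel> \<chi>) = (hidc A (vid A (hdom A f)) \<oslash> \<kappa>) \<parallel> (\<psi> \<oslash> \<chi>)"
      by (rule interchange) simp_all
    then show ?thesis by simp
  qed
  from this[OF g(1)] this[OF g(2)] eq show ?thesis by simp
qed

end

locale strict_with_companions = strict_double_category A + companion_double_category A
  for A :: "('o, 'h, 'v, 'c, 'x) dblcat_comp_scheme" (structure)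
begin

text \<open>The binding cell \<open>\<chi>\<close> of the composite companion \<open>h\<^sub>* \<bullet> f\<^sub>*\<close> of \<open>hf\<close>.\<close>

definition comp_chi :: "'h \<Rightarrow> 'h \<Rightarrow> 'c" where
  "comp_chi h f = (cchi A f \<parallel> vidc A h) \<oslash> cchi A h"

lemma comp_chi_simps [simp]:
  assumes "f \<in> hors A" "h \<in> hors A" "hcod A f = hdom A h"
  shows "comp_chi h f \<in> cells A" "ctop A (comp_chi h f) = h \<odot> f"
    "cleft A (comp_chi h f) = companion A h \<bullet> companion A f"
    "cright A (comp_chi h f) = vid A (hcod A h)" "cbot A (comp_chi h f) = hid A (hcod A h)"
  using assms by (simp_all add: comp_chi_def)

lemma companion_comp_chi:
  assumes "f \<in> hors A" "h \<in> hors A" "hcod A f = hdom A h"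
  shows "is_companion A (h \<odot> f) (companion A h \<bullet> companion A f)
    (cpsi A f \<oslash> (vidc A f \<parallel> cpsi A h)) (comp_chi h f)"
  unfolding comp_chi_def using assms by (intro companion_comp has_companion)

lemma comp_iso_comp_chi [simp]:
  assumes "f \<in> hors A" "h \<in> hors A" "hcod A f = hdom A h"
  shows "comp_iso A h f \<parallel> comp_chi h f = cchi A (h \<odot> f)"
  using comparison_chi[OF has_companion[of "h \<odot> f"] companion_comp_chi[of f h]] assms
  by (simp add: comp_iso_def)

lemma comp_iso_inv_cchi [simp]:
  assumes "f \<in> hors A" "h \<in> hors A" "hcod A f = hdom A h"
  shows "comp_iso_inv A h f \<parallel> cchi A (h \<odot> f) = comp_chi h f"
  using comparison_chi[OF companion_comp_chi[of f h] has_companion[of "h \<odot> f"]] assms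
  by (simp add: comp_iso_inv_def comp_chi_def)

lemma comp_chi_assoc:
  assumes "f \<in> hors A" "h \<in> hors A" "l \<in> hors A" "hcod A f = hdom A h" "hcod A h = hdom A l"
  shows "(comp_chi h f \<parallel> vidc A l) \<oslash> cchi A l = (cchi A f \<parallel> vidc A (l \<odot> h)) \<oslash> comp_chi l h"
proof -
  note [simp] = assms
  have "((cchi A f \<parallel> vidc A h) \<oslash> cchi A h) \<parallel> (vidc A l \<oslash> vidc A l)
      = ((cchi A f \<parallel> vidc A h) \<parallel> vidc A l) \<oslash> (cchi A h \<parallel> vidc A l)"
    by (rule interchange[symmetric]) simp_all
  then show ?thesis by (simp add: comp_chi_def)
qed

text \<open>Both sides compare the chosen companion of \<open>lhf\<close> with the companion \<open>l\<^sub>* \<bullet> h\<^sub>* \<bullet> f\<^sub>*\<close>, so it is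
  enough to see that each carries the binding cell of the latter, in one of its two bracketings, to
  that of the former.\<close>

lemma comp_iso_assoc:
  assumes "f \<in> hors A" "h \<in> hors A" "l \<in> hors A" "hcod A f = hdom A h" "hcod A h = hdom A l"
  shows "comp_iso A l (h \<odot> f) \<parallel> (comp_iso A h f \<oslash> hidc A (companion A l))
    = comp_iso A (l \<odot> h) f \<parallel> (hidc A (companion A f) \<oslash> comp_iso A l h)"
proof (rule companion_cancel)
  note [simp] = assms
  show "is_companion A (l \<odot> (h \<odot> f)) (companion A l \<bullet> (companion A h \<bullet> companion A f))
      ((cpsi A f \<oslash> (vidc A f \<parallel> cpsi A h)) \<oslash> (vidc A (h \<odot> f) \<parallel> cpsi A l))
      ((comp_chi h f \<parallel> vidc A l) \<oslash> cchi A l)"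
    by (intro companion_comp has_companion companion_comp_chi) simp_all
  show "l \<odot> (h \<odot> f) \<in> hors A" by simp
  show "globular A (comp_iso A l (h \<odot> f) \<parallel> (comp_iso A h f \<oslash> hidc A (companion A l)))
      (companion A (l \<odot> (h \<odot> f))) (companion A l \<bullet> (companion A h \<bullet> companion A f))"
    "globular A (comp_iso A (l \<odot> h) f \<parallel> (hidc A (companion A f) \<oslash> comp_iso A l h))
      (companion A (l \<odot> (h \<odot> f))) (companion A l \<bullet> (companion A h \<bullet> companion A f))"
    by (auto intro!: globularI)
  have 1: "(comp_iso A h f \<oslash> hidc A (companion A l)) \<parallel> ((comp_chi h f \<parallel> vidc A l) \<oslash> cchi A l)
      = comp_chi l (h \<odot> f)"
  proof -
    have "(comp_iso A h f \<oslash> hidc A (companion A l)) \<parallel> ((comp_chi h f \<parallel> vidc A l) \<oslash> cchi A l)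
      = (comp_iso A h f \<parallel> (comp_chi h f \<parallel> vidc A l)) \<oslash> (hidc A (companion A l) \<parallel> cchi A l)"
      by (rule interchange[symmetric]) simp_all
    also have "comp_iso A h f \<parallel> (comp_chi h f \<parallel> vidc A l) = cchi A (h \<odot> f) \<parallel> vidc A l"
      by (subst hpaste_assoc[symmetric]) simp_all
    finally show ?thesis by (simp add: comp_chi_def)
  qed
  have 2: "(hidc A (companion A f) \<oslash> comp_iso A l h) \<parallel> ((comp_chi h f \<parallel> vidc A l) \<oslash> cchi A l)
      = comp_chi (l \<odot> h) f"
    unfolding comp_chi_assoc[OF assms]
    using interchange[of "hidc A (companion A f)" "cchi A f \<parallel> vidc A (l \<odot> h)" "comp_iso A l h" "comp_chi l h"]
    by (simp add: comp_chi_def[of "l \<odot> h"])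
  show "comp_iso A l (h \<odot> f) \<parallel> (comp_iso A h f \<oslash> hidc A (companion A l)) \<parallel> ((comp_chi h f \<parallel> vidc A l) \<oslash> cchi A l)
    = comp_iso A (l \<odot> h) f \<parallel> (hidc A (companion A f) \<oslash> comp_iso A l h) \<parallel> ((comp_chi h f \<parallel> vidc A l) \<oslash> cchi A l)"
    using 1 2 by simp
qed

text \<open>The same argument in the other direction: after composition with the chosen \<open>\<chi>\<close> of \<open>lhf\<close>, both
  sides become the binding cell of \<open>l\<^sub>* \<bullet> h\<^sub>* \<bullet> f\<^sub>*\<close>.\<close>

lemma comp_iso_inv_assoc:
  assumes "f \<in> hors A" "h \<in> hors A" "l \<in> hors A" "hcod A f = hdom A h" "hcod A h = hdom A l"
  shows "(comp_iso_inv A h f \<oslash> hidc A (companion A l)) \<parallel> comp_iso_inv A l (h \<odot> f)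
    = (hidc A (companion A f) \<oslash> comp_iso_inv A l h) \<parallel> comp_iso_inv A (l \<odot> h) f"
proof (rule companion_cancel)
  note [simp] = assms
  show "is_companion A (l \<odot> (h \<odot> f)) (companion A (l \<odot> (h \<odot> f)))
      (cpsi A (l \<odot> (h \<odot> f))) (cchi A (l \<odot> (h \<odot> f)))"
    by (intro has_companion) simp_all
  show "l \<odot> (h \<odot> f) \<in> hors A" by simp
  show "globular A ((comp_iso_inv A h f \<oslash> hidc A (companion A l)) \<parallel> comp_iso_inv A l (h \<odot> f))
      (companion A l \<bullet> (companion A h \<bullet> companion A f)) (companion A (l \<odot> (h \<odot> f)))"
    "globular A ((hidc A (companion A f) \<oslash> comp_iso_inv A l h) \<parallel> comp_iso_inv A (l \<odot> h) f)
      (companion A l \<bullet> (companion A h \<bullet> companion A f)) (companion A (l \<odot> (h \<odot> f)))"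
    by (auto intro!: globularI)
  have 1: "(comp_iso_inv A h f \<oslash> hidc A (companion A l)) \<parallel> comp_chi l (h \<odot> f)
      = (comp_chi h f \<parallel> vidc A l) \<oslash> cchi A l"
  proof -
    have "(comp_iso_inv A h f \<oslash> hidc A (companion A l)) \<parallel> ((cchi A (h \<odot> f) \<parallel> vidc A l) \<oslash> cchi A l)
      = (comp_iso_inv A h f \<parallel> (cchi A (h \<odot> f) \<parallel> vidc A l)) \<oslash> (hidc A (companion A l) \<parallel> cchi A l)"
      by (rule interchange[symmetric]) simp_all
    also have "comp_iso_inv A h f \<parallel> (cchi A (h \<odot> f) \<parallel> vidc A l) = comp_chi h f \<parallel> vidc A l"
      by (subst hpaste_assoc[symmetric]) simp_all
    finally show ?thesis by (simp add: comp_chi_def[of l])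
  qed
  have 2: "(hidc A (companion A f) \<oslash> comp_iso_inv A l h) \<parallel> comp_chi (l \<odot> h) f
      = (comp_chi h f \<parallel> vidc A l) \<oslash> cchi A l"
    unfolding comp_chi_assoc[OF assms]
    using interchange[of "hidc A (companion A f)" "cchi A f \<parallel> vidc A (l \<odot> h)" "comp_iso_inv A l h"
        "cchi A (l \<odot> h)"]
    by (simp add: comp_chi_def[of "l \<odot> h"])
  show "(comp_iso_inv A h f \<oslash> hidc A (companion A l)) \<parallel> comp_iso_inv A l (h \<odot> f) \<parallel> cchi A (l \<odot> (h \<odot> f))
    = (hidc A (companion A f) \<oslash> comp_iso_inv A l h) \<parallel> comp_iso_inv A (l \<odot> h) f \<parallel> cchi A (l \<odot> (h \<odot> f))"
    using 1 2 comp_iso_inv_cchi[of f "l \<odot> h"] comp_iso_inv_cchi[of "h \<odot> f" l]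
    by (simp del: comp_iso_inv_cchi)
qed

lemma retro_comp_strict:
  assumes "is_retrocell A \<alpha>" "is_retrocell A \<beta>" "rright \<alpha> = rleft \<beta>"
  shows "rcell (retro_comp A \<beta> \<alpha>) =
    (comp_iso A (rtop \<beta>) (rtop \<alpha>) \<oslash> hidc A (rright \<beta>))
    \<parallel> (hidc A (companion A (rtop \<alpha>)) \<oslash> rcell \<beta>)
    \<parallel> (rcell \<alpha> \<oslash> hidc A (companion A (rbot \<beta>)))
    \<parallel> (hidc A (rleft \<alpha>) \<oslash> comp_iso_inv A (rbot \<beta>) (rbot \<alpha>))"
proof -
  note [simp] = retrocellD[OF assms(1), unfolded assms(3)] retrocellD[OF assms(2)] assms(3)
  have [simp]: "hcod A (rtop \<alpha>) = hdom A (rtop \<beta>)" "hcod A (rbot \<alpha>) = hdom A (rbot \<beta>)"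
    using retrocellD(7,8)[OF assms(1)] retrocellD(5,6)[OF assms(2)] assms(3) by auto
  show ?thesis by (simp add: retro_comp_def Let_def)
qed

text \<open>Both composites reduce to the pasting of \<open>\<gamma>\<close>, \<open>\<beta>\<close>, \<open>\<alpha>\<close> suitably whiskered, between a comparison
  \<open>(lhf)\<^sub>* \<cong> l\<^sub>* \<bullet> h\<^sub>* \<bullet> f\<^sub>*\<close> on the left and a comparison \<open>m\<^sub>* \<bullet> k\<^sub>* \<bullet> g\<^sub>* \<cong> (mkg)\<^sub>*\<close> on the right. The inner
  comparisons reach the outside by sliding past \<open>\<gamma>\<close> and past \<open>\<alpha>\<close>.\<close>

lemma retro_comp_assoc_strict:
  assumes r: "is_retrocell A \<alpha>" "is_retrocell A \<beta>" "is_retrocell A \<gamma>"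
    and c: "rright \<alpha> = rleft \<beta>" "rright \<beta> = rleft \<gamma>"
  shows "retro_comp A \<gamma> (retro_comp A \<beta> \<alpha>) = retro_comp A (retro_comp A \<gamma> \<beta>) \<alpha>"
proof -
  note [simp] = retrocellD[OF r(1), unfolded c(1)] retrocellD[OF r(2), unfolded c(2)] retrocellD[OF r(3)] c
    composable_retrocells[OF r(1,2) c(1)] composable_retrocells[OF r(2,3) c(2)]
  let ?K = "companion A" and ?I = "hidc A"
  let ?f = "rtop \<alpha>" and ?h = "rtop \<beta>" and ?l = "rtop \<gamma>"
  let ?g = "rbot \<alpha>" and ?k = "rbot \<beta>" and ?m = "rbot \<gamma>"
  let ?v = "rleft \<alpha>" and ?w = "rleft \<beta>" and ?x = "rleft \<gamma>" and ?y = "rright \<gamma>"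
  have slide1: "(?I (?K (?h \<odot> ?f)) \<oslash> rcell \<gamma>) \<parallel> (comp_iso A ?h ?f \<oslash> ?I (?K ?m \<bullet> ?x))
      = (comp_iso A ?h ?f \<oslash> ?I (?y \<bullet> ?K ?l)) \<parallel> (?I (?K ?h \<bullet> ?K ?f) \<oslash> rcell \<gamma>)"
    using vpaste_left_first[of "comp_iso A ?h ?f" "rcell \<gamma>" "hcod A ?h"]
      vpaste_right_first[of "comp_iso A ?h ?f" "rcell \<gamma>" "hcod A ?h"] by simp
  have slide2: "(?I (?w \<bullet> ?K ?f) \<oslash> comp_iso_inv A ?m ?k) \<parallel> (rcell \<alpha> \<oslash> ?I (?K (?m \<odot> ?k)))
      = (rcell \<alpha> \<oslash> ?I (?K ?m \<bullet> ?K ?k)) \<parallel> (?I (?K ?g \<bullet> ?v) \<oslash> comp_iso_inv A ?m ?k)"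
    using vpaste_left_first[of "rcell \<alpha>" "comp_iso_inv A ?m ?k" "hcod A ?g"]
      vpaste_right_first[of "rcell \<alpha>" "comp_iso_inv A ?m ?k" "hcod A ?g"] by simp
  have iso: "(comp_iso A ?l (?h \<odot> ?f) \<oslash> ?I ?y) \<parallel> (comp_iso A ?h ?f \<oslash> ?I (?y \<bullet> ?K ?l))
      = (comp_iso A (?l \<odot> ?h) ?f \<oslash> ?I ?y) \<parallel> (?I (?K ?f) \<oslash> (comp_iso A ?l ?h \<oslash> ?I ?y))"
    using arg_cong[OF comp_iso_assoc[of ?f ?h ?l], of "\<lambda>\<kappa>. \<kappa> \<oslash> ?I ?y"]
    by (simp add: whisker_distribs)
  have inv: "(?I ?v \<oslash> (comp_iso_inv A ?k ?g \<oslash> ?I (?K ?m))) \<parallel> (?I ?v \<oslash> comp_iso_inv A ?m (?k \<odot> ?g))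
      = (?I (?K ?g \<bullet> ?v) \<oslash> comp_iso_inv A ?m ?k) \<parallel> (?I ?v \<oslash> comp_iso_inv A (?m \<odot> ?k) ?g)"
    using arg_cong[OF comp_iso_inv_assoc[of ?g ?k ?m], of "\<lambda>\<kappa>. ?I ?v \<oslash> \<kappa>"]
    by (simp add: whisker_distribs)
  let ?mid = "(?I (?K ?h \<bullet> ?K ?f) \<oslash> rcell \<gamma>) \<parallel> ((?I (?K ?f) \<oslash> (rcell \<beta> \<oslash> ?I (?K ?m)))
      \<parallel> (rcell \<alpha> \<oslash> ?I (?K ?m \<bullet> ?K ?k)))"
  have "rcell (retro_comp A \<gamma> (retro_comp A \<beta> \<alpha>))
    = (comp_iso A ?l (?h \<odot> ?f) \<oslash> ?I ?y)
      \<parallel> (((?I (?K (?h \<odot> ?f)) \<oslash> rcell \<gamma>) \<parallel> (comp_iso A ?h ?f \<oslash> ?I (?K ?m \<bullet> ?x)))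
      \<parallel> ((?I (?K ?f) \<oslash> (rcell \<beta> \<oslash> ?I (?K ?m))) \<parallel> ((rcell \<alpha> \<oslash> ?I (?K ?m \<bullet> ?K ?k))
      \<parallel> ((?I ?v \<oslash> (comp_iso_inv A ?k ?g \<oslash> ?I (?K ?m))) \<parallel> (?I ?v \<oslash> comp_iso_inv A ?m (?k \<odot> ?g))))))"
    using r c retro_comp_is_retrocell[OF r(1,2) c(1)]
    by (simp add: retro_comp_strict whisker_distribs)
  also have "\<dots> = ((comp_iso A ?l (?h \<odot> ?f) \<oslash> ?I ?y) \<parallel> (comp_iso A ?h ?f \<oslash> ?I (?y \<bullet> ?K ?l)))
      \<parallel> (?mid \<parallel> ((?I ?v \<oslash> (comp_iso_inv A ?k ?g \<oslash> ?I (?K ?m))) \<parallel> (?I ?v \<oslash> comp_iso_inv A ?m (?k \<odot> ?g))))"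
    unfolding slide1 by simp
  also have "\<dots> = ((comp_iso A (?l \<odot> ?h) ?f \<oslash> ?I ?y) \<parallel> (?I (?K ?f) \<oslash> (comp_iso A ?l ?h \<oslash> ?I ?y)))
      \<parallel> (?mid \<parallel> ((?I (?K ?g \<bullet> ?v) \<oslash> comp_iso_inv A ?m ?k) \<parallel> (?I ?v \<oslash> comp_iso_inv A (?m \<odot> ?k) ?g)))"
    unfolding iso inv ..
  also have "\<dots> = (comp_iso A (?l \<odot> ?h) ?f \<oslash> ?I ?y) \<parallel> ((?I (?K ?f) \<oslash> (comp_iso A ?l ?h \<oslash> ?I ?y))
      \<parallel> ((?I (?K ?h \<bullet> ?K ?f) \<oslash> rcell \<gamma>) \<parallel> ((?I (?K ?f) \<oslash> (rcell \<beta> \<oslash> ?I (?K ?m)))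
      \<parallel> (((?I (?w \<bullet> ?K ?f) \<oslash> comp_iso_inv A ?m ?k) \<parallel> (rcell \<alpha> \<oslash> ?I (?K (?m \<odot> ?k))))
      \<parallel> (?I ?v \<oslash> comp_iso_inv A (?m \<odot> ?k) ?g)))))"
    unfolding slide2 by simp
  also have "\<dots> = rcell (retro_comp A (retro_comp A \<gamma> \<beta>) \<alpha>)"
    using r c retro_comp_is_retrocell[OF r(2,3) c(2)]
    by (simp add: retro_comp_strict whisker_distribs)
  finally show ?thesis
    by (intro retrocell.equality) simp_all
qed

text \<open>The defining equation of \<open>\<beta> \<setminus> \<gamma>\<close>, for arbitrary cells \<open>\<epsilon>\<close> in place of the evaluation cells, is
  stable under horizontal composition. The binding cell of \<open>b'b\<close> is replaced by that of the composite
  companion, which separates \<open>\<xi>\<close> from \<open>\<xi>'\<close>. Then the equation of \<open>\<xi>'\<close> produces \<open>\<beta>'\<close>, which is slid to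
  the left of \<open>\<xi>\<close>; what remains next to \<open>\<xi>\<close> is the left side of its own equation, whiskered by the
  companion of \<open>c'\<close>.\<close>

lemma hom_equation_comp:
  assumes r: "is_retrocell A \<beta>" "is_retrocell A \<beta>'" "rright \<beta> = rleft \<beta>'"
    and g: "\<gamma> \<in> cells A" "\<gamma>' \<in> cells A" "cright A \<gamma> = cleft A \<gamma>'" "rbot \<beta> = cbot A \<gamma>" "rbot \<beta>' = cbot A \<gamma>'"
    and x: "is_cell A \<xi> (ctop A \<gamma>) u u' (rtop \<beta>)" "is_cell A \<xi>' (ctop A \<gamma>') u' u'' (rtop \<beta>')"
    and e: "globular A \<epsilon> (rleft \<beta> \<bullet> u) (cleft A \<gamma>)" "globular A \<epsilon>' (rleft \<beta>' \<bullet> u') (cleft A \<gamma>')"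
      "globular A \<epsilon>'' (rright \<beta>' \<bullet> u'') (cright A \<gamma>')"
    and E: "\<xi> \<oslash> (cchi A (rtop \<beta>) \<oslash> hidc A (rleft \<beta>')) \<parallel> \<epsilon>'
      = (hidc A u \<oslash> rcell \<beta>) \<parallel> (\<epsilon> \<oslash> hidc A (companion A (rbot \<beta>))) \<parallel> (\<gamma> \<oslash> cchi A (rbot \<beta>))"
    and E': "\<xi>' \<oslash> (cchi A (rtop \<beta>') \<oslash> hidc A (rright \<beta>')) \<parallel> \<epsilon>''
      = (hidc A u' \<oslash> rcell \<beta>') \<parallel> (\<epsilon>' \<oslash> hidc A (companion A (rbot \<beta>'))) \<parallel> (\<gamma>' \<oslash> cchi A (rbot \<beta>'))"
  shows "(\<xi> \<parallel> \<xi>') \<oslash> (cchi A (rtop \<beta>' \<odot> rtop \<beta>) \<oslash> hidc A (rright \<beta>')) \<parallel> \<epsilon>''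
    = (hidc A u \<oslash> rcell (retro_comp A \<beta>' \<beta>)) \<parallel> (\<epsilon> \<oslash> hidc A (companion A (rbot \<beta>' \<odot> rbot \<beta>)))
      \<parallel> ((\<gamma> \<parallel> \<gamma>') \<oslash> cchi A (rbot \<beta>' \<odot> rbot \<beta>))"
proof -
  let ?K = "companion A" and ?I = "hidc A"
  let ?b = "rtop \<beta>" and ?b' = "rtop \<beta>'" and ?c = "rbot \<beta>" and ?k = "rbot \<beta>'"
  let ?y' = "rleft \<beta>'" and ?y'' = "rright \<beta>'"
  note [simp] = r(3) g(3) retrocellD[OF r(1), unfolded r(3)] retrocellD[OF r(2)]
    composable_retrocells[OF r] g(1,2) g(4,5)[symmetric]
  have [simp]: "\<xi> \<in> cells A" "ctop A \<xi> = ctop A \<gamma>" "cleft A \<xi> = u" "cright A \<xi> = u'" "cbot A \<xi> = ?b"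
    "\<xi>' \<in> cells A" "ctop A \<xi>' = ctop A \<gamma>'" "cleft A \<xi>' = u'" "cright A \<xi>' = u''" "cbot A \<xi>' = ?b'"
    using x by (auto simp: is_cell_def)
  have [simp]: "u \<in> vers A" "u' \<in> vers A" "u'' \<in> vers A"
    using cleft_ver[of \<xi>] cright_ver[of \<xi>] cright_ver[of \<xi>'] by simp_all
  have [simp]: "vdom A u = vdom A (cleft A \<gamma>)" "vdom A u' = vdom A (cleft A \<gamma>')"
    "vdom A u'' = vdom A (cright A \<gamma>')" "vcod A u = hdom A ?b" "vcod A u' = hdom A ?b'"
    "vcod A u'' = hcod A ?b'"
    using cell_simps(3-6)[of \<xi>] cell_simps(3-6)[of \<xi>'] cell_simps(3-6)[of \<gamma>] cell_simps(3-6)[of \<gamma>']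
    by auto
  have [simp]: "vcod A (cleft A \<gamma>) = hdom A ?c" "vcod A (cleft A \<gamma>') = hdom A ?k"
      "vcod A (cright A \<gamma>') = hcod A ?k"
    using cell_simps(5,6)[of \<gamma>] cell_simps(5,6)[of \<gamma>'] by auto
  note [simp] = globularD[OF e(1)] globularD[OF e(2)] globularD[OF e(3)]
  let ?\<chi> = "cchi A ?b" and ?\<chi>' = "cchi A ?b'"
  let ?R = "(\<gamma> \<oslash> (cchi A ?c \<oslash> ?I (?K ?k))) \<parallel> (\<gamma>' \<oslash> cchi A ?k)"
  \<comment> \<open>After inserting the comparison for \<open>b'b\<close>, the cells \<open>\<xi>\<close> and \<open>\<xi>'\<close> lie in separate columns.\<close>
  have split: "(\<xi> \<parallel> \<xi>') \<oslash> (cchi A (?b' \<odot> ?b) \<oslash> ?I ?y'')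
      = (?I u \<oslash> (comp_iso A ?b' ?b \<oslash> ?I ?y''))
        \<parallel> ((\<xi> \<oslash> (?\<chi> \<oslash> ?I (?y'' \<bullet> ?K ?b'))) \<parallel> (\<xi>' \<oslash> (?\<chi>' \<oslash> ?I ?y'')))"
  proof -
    have "(\<xi> \<parallel> \<xi>') \<oslash> (cchi A (?b' \<odot> ?b) \<oslash> ?I ?y'')
        = (?I u \<parallel> (\<xi> \<parallel> \<xi>')) \<oslash> ((comp_iso A ?b' ?b \<oslash> ?I ?y'') \<parallel> (comp_chi ?b' ?b \<oslash> ?I ?y''))"
      by (subst comp_iso_comp_chi[symmetric]) (simp_all add: whisker_distribs del: comp_iso_comp_chi)
    also have "\<dots> = (?I u \<oslash> (comp_iso A ?b' ?b \<oslash> ?I ?y''))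
        \<parallel> ((\<xi> \<parallel> \<xi>') \<oslash> (comp_chi ?b' ?b \<oslash> ?I ?y''))"
      by (rule interchange) simp_all
    also have "(\<xi> \<parallel> \<xi>') \<oslash> (comp_chi ?b' ?b \<oslash> ?I ?y'')
        = ((\<xi> \<parallel> \<xi>') \<oslash> (?\<chi> \<parallel> vidc A ?b')) \<oslash> (?\<chi>' \<oslash> ?I ?y'')"
      by (simp add: comp_chi_def)
    also have "(\<xi> \<parallel> \<xi>') \<oslash> (?\<chi> \<parallel> vidc A ?b') = (\<xi> \<oslash> ?\<chi>) \<parallel> \<xi>'"
      using interchange[of \<xi> \<xi>' ?\<chi> "vidc A ?b'"] by simp
    also have "((\<xi> \<oslash> ?\<chi>) \<parallel> \<xi>') \<oslash> (?\<chi>' \<oslash> ?I ?y'')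
        = (\<xi> \<oslash> (?\<chi> \<oslash> ?I (?y'' \<bullet> ?K ?b'))) \<parallel> (\<xi>' \<oslash> (?\<chi>' \<oslash> ?I ?y''))"
      using interchange[of "\<xi> \<oslash> ?\<chi>" \<xi>' "?I (?y'' \<bullet> ?K ?b')" "?\<chi>' \<oslash> ?I ?y''"] by simp
    finally show ?thesis .
  qed
  have slide1: "(\<xi> \<oslash> (?\<chi> \<oslash> ?I (?y'' \<bullet> ?K ?b'))) \<parallel> (?I u' \<oslash> rcell \<beta>')
      = (?I (?K ?b \<bullet> u) \<oslash> rcell \<beta>') \<parallel> (\<xi> \<oslash> (?\<chi> \<oslash> ?I (?K ?k \<bullet> ?y')))"
    using vpaste_left_first[of "\<xi> \<oslash> ?\<chi>" "rcell \<beta>'" "hcod A ?b"]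
      vpaste_right_first[of "\<xi> \<oslash> ?\<chi>" "rcell \<beta>'" "hcod A ?b"] by simp
  \<comment> \<open>The equation of \<open>\<xi>\<close>, whiskered below.\<close>
  have whisk: "(\<xi> \<oslash> (?\<chi> \<oslash> ?I (?K ?k \<bullet> ?y'))) \<parallel> (\<epsilon>' \<oslash> ?I (?K ?k))
      = (?I u \<oslash> (rcell \<beta> \<oslash> ?I (?K ?k))) \<parallel> ((\<epsilon> \<oslash> ?I (?K ?k \<bullet> ?K ?c)) \<parallel> (\<gamma> \<oslash> (cchi A ?c \<oslash> ?I (?K ?k))))"
    using arg_cong[OF E, of "\<lambda>\<kappa>. \<kappa> \<oslash> ?I (?K ?k)"] by (simp add: whisker_distribs)
  \<comment> \<open>On the far right, the binding cells of \<open>c\<close> and \<open>c'\<close> assemble to that of the composite companion.\<close>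
  have R: "?R = (\<gamma> \<parallel> \<gamma>') \<oslash> comp_chi ?k ?c"
    using interchange[of \<gamma> \<gamma>' "cchi A ?c \<oslash> ?I (?K ?k)" "cchi A ?k"]
      interchange[of "cchi A ?c" "vidc A ?k" "?I (?K ?k)" "cchi A ?k"] by (simp add: comp_chi_def)
  have slide2: "(?I (rleft \<beta> \<bullet> u) \<oslash> comp_iso_inv A ?k ?c) \<parallel> (\<epsilon> \<oslash> ?I (?K (?k \<odot> ?c)))
      = (\<epsilon> \<oslash> ?I (?K ?k \<bullet> ?K ?c)) \<parallel> (?I (cleft A \<gamma>) \<oslash> comp_iso_inv A ?k ?c)"
    using vpaste_left_first[of \<epsilon> "comp_iso_inv A ?k ?c" "hdom A ?c"]
      vpaste_right_first[of \<epsilon> "comp_iso_inv A ?k ?c" "hdom A ?c"] by simp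
  have R': "(?I (cleft A \<gamma>) \<oslash> comp_iso_inv A ?k ?c) \<parallel> ((\<gamma> \<parallel> \<gamma>') \<oslash> cchi A (?k \<odot> ?c))
      = (\<gamma> \<parallel> \<gamma>') \<oslash> comp_chi ?k ?c"
    using interchange[of "?I (cleft A \<gamma>)" "\<gamma> \<parallel> \<gamma>'" "comp_iso_inv A ?k ?c" "cchi A (?k \<odot> ?c)"] by simp
  have "(\<xi> \<parallel> \<xi>') \<oslash> (cchi A (?b' \<odot> ?b) \<oslash> ?I ?y'') \<parallel> \<epsilon>''
      = (?I u \<oslash> (comp_iso A ?b' ?b \<oslash> ?I ?y'')) \<parallel> ((\<xi> \<oslash> (?\<chi> \<oslash> ?I (?y'' \<bullet> ?K ?b')))
        \<parallel> ((\<xi>' \<oslash> (?\<chi>' \<oslash> ?I ?y'')) \<parallel> \<epsilon>''))"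
    unfolding split by simp
  also have "\<dots> = (?I u \<oslash> (comp_iso A ?b' ?b \<oslash> ?I ?y''))
      \<parallel> (((\<xi> \<oslash> (?\<chi> \<oslash> ?I (?y'' \<bullet> ?K ?b'))) \<parallel> (?I u' \<oslash> rcell \<beta>'))
      \<parallel> ((\<epsilon>' \<oslash> ?I (?K ?k)) \<parallel> (\<gamma>' \<oslash> cchi A ?k)))"
    unfolding E' by simp
  also have "\<dots> = (?I u \<oslash> (comp_iso A ?b' ?b \<oslash> ?I ?y'')) \<parallel> ((?I (?K ?b \<bullet> u) \<oslash> rcell \<beta>')
      \<parallel> (((\<xi> \<oslash> (?\<chi> \<oslash> ?I (?K ?k \<bullet> ?y'))) \<parallel> (\<epsilon>' \<oslash> ?I (?K ?k))) \<parallel> (\<gamma>' \<oslash> cchi A ?k)))"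
    unfolding slide1 by simp
  also have "\<dots> = (?I u \<oslash> (comp_iso A ?b' ?b \<oslash> ?I ?y'')) \<parallel> ((?I (?K ?b \<bullet> u) \<oslash> rcell \<beta>')
      \<parallel> ((?I u \<oslash> (rcell \<beta> \<oslash> ?I (?K ?k))) \<parallel> ((\<epsilon> \<oslash> ?I (?K ?k \<bullet> ?K ?c)) \<parallel> ?R)))"
    unfolding whisk by simp
  also have "\<dots> = (?I u \<oslash> (comp_iso A ?b' ?b \<oslash> ?I ?y'')) \<parallel> ((?I (?K ?b \<bullet> u) \<oslash> rcell \<beta>')
      \<parallel> ((?I u \<oslash> (rcell \<beta> \<oslash> ?I (?K ?k))) \<parallel> (((?I (rleft \<beta> \<bullet> u) \<oslash> comp_iso_inv A ?k ?c)
      \<parallel> (\<epsilon> \<oslash> ?I (?K (?k \<odot> ?c)))) \<parallel> ((\<gamma> \<parallel> \<gamma>') \<oslash> cchi A (?k \<odot> ?c)))))"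
    unfolding R slide2 by (simp add: R')
  also have "\<dots> = (?I u \<oslash> rcell (retro_comp A \<beta>' \<beta>)) \<parallel> (\<epsilon> \<oslash> ?I (?K (?k \<odot> ?c)))
      \<parallel> ((\<gamma> \<parallel> \<gamma>') \<oslash> cchi A (?k \<odot> ?c))"
    by (simp add: retro_comp_strict[OF r] whisker_distribs)
  finally show ?thesis .
qed

end

section \<open>Strictification by paths\<close>

text \<open>A path is a starting object together with a list of vertical arrows, first arrow first; the
  starting object makes the empty path at each object possible. With this recursion \<open>path_comp\<close> brackets
  from the right end of the list, so that \<open>[f, h, x]\<close> has composite \<open>(x \<bullet> h) \<bullet> f\<close>. As vertical
  identities are strict, a path of length one has its only arrow as composite.\<close>

context
  fixes A :: "('o, 'h, 'v, 'c, 'x) dblcat_scheme" (structure)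
begin

fun is_path :: "'o \<Rightarrow> 'v list \<Rightarrow> bool" where
  "is_path X [] \<longleftrightarrow> X \<in> objs A"
| "is_path X (v # p) \<longleftrightarrow> v \<in> vers A \<and> vdom A v = X \<and> is_path (vcod A v) p"

fun path_cod :: "'o \<Rightarrow> 'v list \<Rightarrow> 'o" where
  "path_cod X [] = X"
| "path_cod X (v # p) = path_cod (vcod A v) p"

fun path_comp :: "'o \<Rightarrow> 'v list \<Rightarrow> 'v" where
  "path_comp X [] = vid A X"
| "path_comp X (v # p) = path_comp (vcod A v) p \<bullet> v"

text \<open>The isomorphism \<open>|p @ q| \<Rightarrow> |q| \<bullet> |p|\<close> and, as \<open>cut\<close>, its inverse. They are identities when \<open>p\<close> has
  length at most one, and \<open>join X [f, h] [x]\<close> is the associativity isomorphism of \<open>x\<close>, \<open>h\<close>, \<open>f\<close>.\<close>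

fun join :: "'o \<Rightarrow> 'v list \<Rightarrow> 'v list \<Rightarrow> 'c" where
  "join X [] q = hidc A (path_comp X q)"
| "join X (v # p) q = (hidc A v \<oslash> join (vcod A v) p q)
    \<parallel> assoc A (path_comp (path_cod (vcod A v) p) q) (path_comp (vcod A v) p) v"

fun cut :: "'o \<Rightarrow> 'v list \<Rightarrow> 'v list \<Rightarrow> 'c" where
  "cut X [] q = hidc A (path_comp X q)"
| "cut X (v # p) q = assoc_inv A (path_comp (path_cod (vcod A v) p) q) (path_comp (vcod A v) p) v
    \<parallel> (hidc A v \<oslash> cut (vcod A v) p q)"

end

context double_category
begin

lemma is_path_append [simp]:
  "is_path A X (p @ q) \<longleftrightarrow> is_path A X p \<and> is_path A (path_cod A X p) q"
  by (induction p arbitrary: X) (auto, (cases q; simp)+)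

lemma path_cod_append [simp]: "path_cod A X (p @ q) = path_cod A (path_cod A X p) q"
  by (induction p arbitrary: X) auto

lemma is_path_objs: "is_path A X p \<Longrightarrow> X \<in> objs A"
  by (cases p) auto

lemma path_comp_simps [simp]:
  assumes "is_path A X p"
  shows "path_comp A X p \<in> vers A" "vdom A (path_comp A X p) = X"
    "vcod A (path_comp A X p) = path_cod A X p" "path_cod A X p \<in> objs A"
  using assms by (induction p arbitrary: X) auto

lemma join_simps [simp]:
  assumes "is_path A X p" "is_path A (path_cod A X p) q"
  shows "join A X p q \<in> cells A" "ctop A (join A X p q) = hid A X"
    "cbot A (join A X p q) = hid A (path_cod A (path_cod A X p) q)"
    "cleft A (join A X p q) = path_comp A X (p @ q)"
    "cright A (join A X p q) = path_comp A (path_cod A X p) q \<bullet> path_comp A X p"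
  using assms by (induction p arbitrary: X) (auto dest: is_path_objs)

lemma cut_simps [simp]:
  assumes "is_path A X p" "is_path A (path_cod A X p) q"
  shows "cut A X p q \<in> cells A" "ctop A (cut A X p q) = hid A X"
    "cbot A (cut A X p q) = hid A (path_cod A (path_cod A X p) q)"
    "cleft A (cut A X p q) = path_comp A (path_cod A X p) q \<bullet> path_comp A X p"
    "cright A (cut A X p q) = path_comp A X (p @ q)"
  using assms by (induction p arbitrary: X) (auto dest: is_path_objs)

lemma hpaste_cancel:
  assumes "\<alpha> \<in> cells A" "\<beta> \<in> cells A" "cright A \<alpha> = cleft A \<beta>" "\<alpha> \<parallel> \<beta> = hidc A v" "cleft A \<alpha> = v"
    "\<gamma> \<in> cells A" "cleft A \<gamma> = cright A \<beta>"
  shows "\<alpha> \<parallel> (\<beta> \<parallel> \<gamma>) = \<gamma>"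
proof -
  have "cright A \<beta> = v"
    using hpaste_simps(4)[OF assms(1-3)] assms by (metis cleft_ver hidc_simps(4))
  then show ?thesis using hpaste_assoc[of \<alpha> \<beta> \<gamma>] assms by simp
qed

lemma assoc_cancel [simp]:
  assumes "v \<in> vers A" "w \<in> vers A" "x \<in> vers A" "vcod A v = vdom A w" "vcod A w = vdom A x"
    and "\<gamma> \<in> cells A"
  shows "cleft A \<gamma> = (x \<bullet> w) \<bullet> v \<Longrightarrow> assoc A x w v \<parallel> (assoc_inv A x w v \<parallel> \<gamma>) = \<gamma>"
    "cleft A \<gamma> = x \<bullet> (w \<bullet> v) \<Longrightarrow> assoc_inv A x w v \<parallel> (assoc A x w v \<parallel> \<gamma>) = \<gamma>"
  using assms hpaste_cancel[of "assoc A x w v" "assoc_inv A x w v" _ \<gamma>]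
    hpaste_cancel[of "assoc_inv A x w v" "assoc A x w v" _ \<gamma>] by simp_all

lemma join_cut [simp]:
  assumes "is_path A X p" "is_path A (path_cod A X p) q"
  shows "join A X p q \<parallel> cut A X p q = hidc A (path_comp A X (p @ q))"
  using assms
proof (induction p arbitrary: X)
  case (Cons v p)
  let ?Y = "vcod A v"
  have "join A X (v # p) q \<parallel> cut A X (v # p) q = (hidc A v \<oslash> join A ?Y p q) \<parallel> (hidc A v \<oslash> cut A ?Y p q)"
    using Cons.prems by (simp del: is_path_append)
  also have "\<dots> = hidc A v \<oslash> (join A ?Y p q \<parallel> cut A ?Y p q)"
    using Cons.prems by (subst whisker_distribs) (auto dest: is_path_objs)
  finally show ?case using Cons by simp
qed simp

lemma cut_join [simp]:
  assumes "is_path A X p" "is_path A (path_cod A X p) q"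
  shows "cut A X p q \<parallel> join A X p q = hidc A (path_comp A (path_cod A X p) q \<bullet> path_comp A X p)"
  using assms
proof (induction p arbitrary: X)
  case (Cons v p)
  let ?Y = "vcod A v"
  let ?a = "assoc A (path_comp A (path_cod A ?Y p) q) (path_comp A ?Y p) v"
  let ?b = "assoc_inv A (path_comp A (path_cod A ?Y p) q) (path_comp A ?Y p) v"
  have "cut A X (v # p) q \<parallel> join A X (v # p) q
      = ?b \<parallel> (((hidc A v \<oslash> cut A ?Y p q) \<parallel> (hidc A v \<oslash> join A ?Y p q)) \<parallel> ?a)"
    using Cons.prems by (simp del: is_path_append)
  also have "(hidc A v \<oslash> cut A ?Y p q) \<parallel> (hidc A v \<oslash> join A ?Y p q)
      = hidc A v \<oslash> (cut A ?Y p q \<parallel> join A ?Y p q)"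
    using Cons.prems by (subst whisker_distribs) (auto dest: is_path_objs)
  finally show ?case using Cons by simp
qed simp

lemma join_cut_cancel [simp]:
  assumes "is_path A X p" "is_path A (path_cod A X p) q" "\<gamma> \<in> cells A"
  shows "cleft A \<gamma> = path_comp A X (p @ q) \<Longrightarrow> join A X p q \<parallel> (cut A X p q \<parallel> \<gamma>) = \<gamma>"
    "cleft A \<gamma> = path_comp A (path_cod A X p) q \<bullet> path_comp A X p
      \<Longrightarrow> cut A X p q \<parallel> (join A X p q \<parallel> \<gamma>) = \<gamma>"
  using assms hpaste_cancel[of "join A X p q" "cut A X p q" _ \<gamma>]
    hpaste_cancel[of "cut A X p q" "join A X p q" _ \<gamma>] by simp_all

lemma join_cut_Nil [simp]:
  assumes "is_path A X p"
  shows "join A X p [] = hidc A (path_comp A X p)" "cut A X p [] = hidc A (path_comp A X p)"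
  using assms by (induction p arbitrary: X) auto

text \<open>The two ways of splitting the composite of \<open>p @ q @ r\<close> into three agree up to the associativity
  isomorphism of the three composites. When an arrow is added to the front of \<open>p\<close>, naturality brings
  together the associativity isomorphisms that involve it, and the pentagon exchanges them.\<close>

lemma join_assoc:
  assumes "is_path A X p" "is_path A (path_cod A X p) q" "is_path A (path_cod A (path_cod A X p) q) r"
  defines "Y \<equiv> path_cod A X p"
  defines "R \<equiv> path_comp A (path_cod A Y q) r"
  shows "join A X (p @ q) r \<parallel> (join A X p q \<oslash> hidc A R)
    = join A X p (q @ r) \<parallel> (hidc A (path_comp A X p) \<oslash> join A Y q r)
      \<parallel> assoc A R (path_comp A Y q) (path_comp A X p)"
  using assms(1-3) unfolding assms(4,5)
proof (induction p arbitrary: X)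
  case Nil
  then show ?case by (simp add: is_path_objs)
next
  case (Cons v p)
  define X' where "X' = vcod A v"
  define Y where "Y = path_cod A X' p"
  define P where "P = path_comp A X' p"
  define Q where "Q = path_comp A Y q"
  define R where "R = path_comp A (path_cod A Y q) r"
  have p [simp]: "is_path A X' p" "is_path A Y q" "is_path A (path_cod A Y q) r" "v \<in> vers A" "vcod A v = X'"
      "path_cod A X' p = Y" "path_comp A X' p = P" "path_comp A Y q = Q" "path_comp A (path_cod A Y q) r = R"
      "vdom A v = X"
    using Cons.prems by (simp_all add: X'_def Y_def P_def Q_def R_def)
  have [simp]: "X' \<in> objs A" "Y \<in> objs A" using is_path_objs[OF p(1)] is_path_objs[OF p(2)] by simp_all
  note [simp] = path_comp_simps[OF p(1), simplified] path_comp_simps[OF p(2), simplified]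
    path_comp_simps[OF p(3), simplified] join_simps(5)[OF p(1), simplified] join_simps(5)[OF p(2), simplified]
  have IH: "join A X' (p @ q) r \<parallel> (join A X' p q \<oslash> hidc A R)
      = join A X' p (q @ r) \<parallel> ((hidc A P \<oslash> join A Y q r) \<parallel> assoc A R Q P)"
    using Cons.IH[of X'] by simp
  have n1: "assoc A R (path_comp A X' (p @ q)) v \<parallel> ((hidc A v \<oslash> join A X' p q) \<oslash> hidc A R)
      = (hidc A v \<oslash> (join A X' p q \<oslash> hidc A R)) \<parallel> assoc A R (Q \<bullet> P) v"
    using assoc_natural'[of "hidc A v" "join A X' p q" "hidc A R"] by simp
  have n2: "(hidc A v \<oslash> (hidc A P \<oslash> join A Y q r)) \<parallel> assoc A (R \<bullet> Q) P v
      = assoc A (path_comp A Y (q @ r)) P v \<parallel> (hidc A (P \<bullet> v) \<oslash> join A Y q r)"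
    using assoc_natural'[of "hidc A v" "hidc A P" "join A Y q r"] by simp
  have pent: "(hidc A v \<oslash> assoc A R Q P) \<parallel> (assoc A R (Q \<bullet> P) v \<parallel> (assoc A Q P v \<oslash> hidc A R))
      = assoc A (R \<bullet> Q) P v \<parallel> assoc A R Q (P \<bullet> v)"
    using pentagon[of v X X' P Y Q "path_cod A Y q" R "path_cod A (path_cod A Y q) r"]
    by (simp add: is_ver_def)
  have "join A X (v # p @ q) r \<parallel> (join A X (v # p) q \<oslash> hidc A R)
      = (hidc A v \<oslash> join A X' (p @ q) r) \<parallel> ((assoc A R (path_comp A X' (p @ q)) v
        \<parallel> ((hidc A v \<oslash> join A X' p q) \<oslash> hidc A R)) \<parallel> (assoc A Q P v \<oslash> hidc A R))"
    by (simp add: whisker_distribs)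
  also have "\<dots> = (hidc A v \<oslash> (join A X' (p @ q) r \<parallel> (join A X' p q \<oslash> hidc A R)))
      \<parallel> (assoc A R (Q \<bullet> P) v \<parallel> (assoc A Q P v \<oslash> hidc A R))"
    unfolding n1 by (simp add: whisker_distribs)
  also have "\<dots> = (hidc A v \<oslash> join A X' p (q @ r)) \<parallel> ((hidc A v \<oslash> (hidc A P \<oslash> join A Y q r))
      \<parallel> ((hidc A v \<oslash> assoc A R Q P) \<parallel> (assoc A R (Q \<bullet> P) v \<parallel> (assoc A Q P v \<oslash> hidc A R))))"
    unfolding IH by (simp add: whisker_distribs)
  also have "\<dots> = (hidc A v \<oslash> join A X' p (q @ r)) \<parallel> (((hidc A v \<oslash> (hidc A P \<oslash> join A Y q r))
      \<parallel> assoc A (R \<bullet> Q) P v) \<parallel> assoc A R Q (P \<bullet> v))"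
    unfolding pent by simp
  also have "\<dots> = join A X (v # p) (q @ r) \<parallel> ((hidc A (P \<bullet> v) \<oslash> join A Y q r) \<parallel> assoc A R Q (P \<bullet> v))"
    unfolding n2 by simp
  finally show ?case by simp
qed

text \<open>This is the inverse of \<open>join_assoc\<close>: both sides are inverse to the same isomorphism.\<close>

lemma cut_assoc:
  assumes "is_path A X p" "is_path A (path_cod A X p) q" "is_path A (path_cod A (path_cod A X p) q) r"
  defines "Y \<equiv> path_cod A X p"
  defines "R \<equiv> path_comp A (path_cod A Y q) r"
  shows "(cut A X p q \<oslash> hidc A R) \<parallel> cut A X (p @ q) r
    = assoc_inv A R (path_comp A Y q) (path_comp A X p)
      \<parallel> (hidc A (path_comp A X p) \<oslash> cut A Y q r) \<parallel> cut A X p (q @ r)"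
proof -
  define P where "P = path_comp A X p"
  define Q where "Q = path_comp A Y q"
  have p [simp]: "is_path A X p" "is_path A Y q" "is_path A (path_cod A Y q) r"
      "path_cod A X p = Y" "path_comp A X p = P" "path_comp A Y q = Q" "path_comp A (path_cod A Y q) r = R"
    using assms by (simp_all add: P_def Q_def)
  note [simp] = path_comp_simps[OF p(1), simplified] path_comp_simps[OF p(2), simplified]
    path_comp_simps[OF p(3), simplified] join_simps(5)[OF p(1), simplified] join_simps(5)[OF p(2), simplified]
    cut_simps(4)[OF p(1), simplified] cut_simps(4)[OF p(2), simplified]
  let ?S = "(cut A X p q \<oslash> hidc A R) \<parallel> cut A X (p @ q) r"
  let ?J = "join A X (p @ q) r \<parallel> (join A X p q \<oslash> hidc A R)"
  let ?K = "join A X p (q @ r) \<parallel> (hidc A P \<oslash> join A Y q r)"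
  let ?L = "(hidc A P \<oslash> cut A Y q r) \<parallel> cut A X p (q @ r)"
  let ?a = "assoc A R Q P" and ?b = "assoc_inv A R Q P"
  have J: "?J = ?K \<parallel> ?a" using join_assoc[of X p q r] by simp
  have "?S \<parallel> ?J = (cut A X p q \<oslash> hidc A R) \<parallel> (join A X p q \<oslash> hidc A R)" by simp
  also have "\<dots> = (cut A X p q \<parallel> join A X p q) \<oslash> hidc A R" by (subst whisker_distribs) simp_all
  finally have SJ: "?S \<parallel> ?J = hidc A (R \<bullet> (Q \<bullet> P))" by simp
  have "(hidc A P \<oslash> join A Y q r) \<parallel> (hidc A P \<oslash> cut A Y q r) = hidc A P \<oslash> (join A Y q r \<parallel> cut A Y q r)"
    by (subst whisker_distribs) simp_all
  then have "((hidc A P \<oslash> join A Y q r) \<parallel> (hidc A P \<oslash> cut A Y q r)) \<parallel> cut A X p (q @ r) = cut A X p (q @ r)"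
    by simp
  then have KL: "?K \<parallel> ?L = hidc A (path_comp A X (p @ (q @ r)))"
    by simp
  have "?S = ?S \<parallel> (?K \<parallel> ?L)" unfolding KL by simp
  also have "\<dots> = (?S \<parallel> (?K \<parallel> ?a)) \<parallel> (?b \<parallel> ?L)" by simp
  also have "\<dots> = ?b \<parallel> ?L" unfolding J[symmetric] SJ by simp
  finally show ?thesis by simp
qed

end

text \<open>Concatenation of paths is strictly associative. A cell records its two paths, because a vertical
  arrow can be the composite of several paths. The chosen companions are those of the given double
  category, as paths of length one.\<close>

definition strictification ::
  "('o, 'h, 'v, 'c, 'x) dblcat_comp_scheme
    \<Rightarrow> ('o, 'h, 'o \<times> 'v list, ('o \<times> 'v list) \<times> 'c \<times> ('o \<times> 'v list)) dblcat_comp" where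
  "strictification A = \<lparr>
     objs = objs A, hors = hors A,
     vers = {(X, p). is_path A X p},
     cells = {((X, p), \<alpha>, (X', p')). is_path A X p \<and> is_path A X' p' \<and> \<alpha> \<in> cells A
       \<and> cleft A \<alpha> = path_comp A X p \<and> cright A \<alpha> = path_comp A X' p'},
     hdom = hdom A, hcod = hcod A, hid = hid A, hcomp = hcomp A,
     vdom = fst, vcod = (\<lambda>(X, p). path_cod A X p), vid = (\<lambda>X. (X, [])),
     vcomp = (\<lambda>(Y, q) (X, p). (X, p @ q)),
     ctop = (\<lambda>(p, \<alpha>, p'). ctop A \<alpha>), cleft = fst, cright = (\<lambda>(p, \<alpha>, p'). p'),
     cbot = (\<lambda>(p, \<alpha>, p'). cbot A \<alpha>),
     hidc = (\<lambda>(X, p). ((X, p), hidc A (path_comp A X p), (X, p))),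
     vidc = (\<lambda>f. ((hdom A f, []), vidc A f, (hcod A f, []))),
     hpaste = (\<lambda>(p, \<alpha>, _) (_, \<beta>, q). (p, \<alpha> \<parallel>\<^bsub>A\<^esub> \<beta>, q)),
     vpaste = (\<lambda>((X, p), \<alpha>, (X', p')) ((_, q), \<beta>, (_, q')).
       ((X, p @ q), join A X p q \<parallel>\<^bsub>A\<^esub> (\<alpha> \<oslash>\<^bsub>A\<^esub> \<beta>) \<parallel>\<^bsub>A\<^esub> cut A X' p' q', (X', p' @ q'))),
     assoc = (\<lambda>(_, r) (_, q) (X, p).
       ((X, p @ q @ r), hidc A (path_comp A X (p @ q @ r)), (X, p @ q @ r))),
     assoc_inv = (\<lambda>(_, r) (_, q) (X, p).
       ((X, p @ q @ r), hidc A (path_comp A X (p @ q @ r)), (X, p @ q @ r))),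
     companion = (\<lambda>f. (hdom A f, [companion A f])),
     cpsi = (\<lambda>f. ((hdom A f, []), cpsi A f, (hdom A f, [companion A f]))),
     cchi = (\<lambda>f. ((hdom A f, [companion A f]), cchi A f, (hcod A f, [])))\<rparr>"

lemma strictification_simps [simp]:
  "objs (strictification A) = objs A" "hors (strictification A) = hors A"
  "(X, p) \<in> vers (strictification A) \<longleftrightarrow> is_path A X p"
  "((X, p), \<alpha>, (X', p')) \<in> cells (strictification A) \<longleftrightarrow> is_path A X p \<and> is_path A X' p' \<and> \<alpha> \<in> cells A
     \<and> cleft A \<alpha> = path_comp A X p \<and> cright A \<alpha> = path_comp A X' p'"
  "hdom (strictification A) = hdom A" "hcod (strictification A) = hcod A"
  "hid (strictification A) = hid A" "hcomp (strictification A) = hcomp A"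
  "vdom (strictification A) = fst" "vcod (strictification A) (X, p) = path_cod A X p"
  "vid (strictification A) X = (X, [])"
  "vcomp (strictification A) (Y, q) (X, p) = (X, p @ q)"
  "ctop (strictification A) (P, \<alpha>, P') = ctop A \<alpha>" "cbot (strictification A) (P, \<alpha>, P') = cbot A \<alpha>"
  "cleft (strictification A) = fst" "cright (strictification A) (P, \<alpha>, P') = P'"
  "hidc (strictification A) (X, p) = ((X, p), hidc A (path_comp A X p), (X, p))"
  "vidc (strictification A) f = ((hdom A f, []), vidc A f, (hcod A f, []))"
  "hpaste (strictification A) (P, \<alpha>, P') (Q', \<beta>, Q) = (P, \<alpha> \<parallel>\<^bsub>A\<^esub> \<beta>, Q)"
  "vpaste (strictification A) ((X, p), \<alpha>, (X', p')) ((Y, q), \<beta>, (Y', q')) =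
     ((X, p @ q), join A X p q \<parallel>\<^bsub>A\<^esub> (\<alpha> \<oslash>\<^bsub>A\<^esub> \<beta>) \<parallel>\<^bsub>A\<^esub> cut A X' p' q', (X', p' @ q'))"
  "assoc (strictification A) (Z, r) (Y, q) (X, p) =
     ((X, p @ q @ r), hidc A (path_comp A X (p @ q @ r)), (X, p @ q @ r))"
  "assoc_inv (strictification A) (Z, r) (Y, q) (X, p) =
     ((X, p @ q @ r), hidc A (path_comp A X (p @ q @ r)), (X, p @ q @ r))"
  "companion (strictification A) f = (hdom A f, [companion A f])"
  "cpsi (strictification A) f = ((hdom A f, []), cpsi A f, (hdom A f, [companion A f]))"
  "cchi (strictification A) f = ((hdom A f, [companion A f]), cchi A f, (hcod A f, []))"
  by (simp_all add: strictification_def)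

context companion_double_category
begin

abbreviation S where "S \<equiv> strictification A"

lemma S_corners:
  assumes "((X, p), \<alpha>, (X', p')) \<in> cells S" "((Y, q), \<beta>, (Y', q')) \<in> cells S" "cbot A \<alpha> = ctop A \<beta>"
  shows "path_cod A X p = Y" "path_cod A X' p' = Y'"
  using matching_corners[of \<alpha> \<beta>] assms by auto

text \<open>The three isomorphisms that occur on each side of a triple pasting are related by \<open>join_assoc\<close> and
  \<open>cut_assoc\<close>, and the associativity isomorphisms left over on the two sides cancel by naturality.\<close>

lemma S_vpaste_assoc:
  assumes "\<alpha> \<in> cells S" "\<beta> \<in> cells S" "\<gamma> \<in> cells S" "cbot S \<alpha> = ctop S \<beta>" "cbot S \<beta> = ctop S \<gamma>"
  shows "(\<alpha> \<oslash>\<^bsub>S\<^esub> \<beta>) \<oslash>\<^bsub>S\<^esub> \<gamma> = \<alpha> \<oslash>\<^bsub>S\<^esub> (\<beta> \<oslash>\<^bsub>S\<^esub> \<gamma>)"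
proof -
  obtain X p a X' p' where \<alpha>: "\<alpha> = ((X, p), a, (X', p'))" by (metis surj_pair)
  obtain Y q b Y' q' where \<beta>: "\<beta> = ((Y, q), b, (Y', q'))" by (metis surj_pair)
  obtain Z r c Z' r' where \<gamma>: "\<gamma> = ((Z, r), c, (Z', r'))" by (metis surj_pair)
  define P where "P = path_comp A X p"
  define P' where "P' = path_comp A X' p'"
  define Q where "Q = path_comp A Y q"
  define Q' where "Q' = path_comp A Y' q'"
  define R where "R = path_comp A Z r"
  define R' where "R' = path_comp A Z' r'"
  have p [simp]: "is_path A X p" "is_path A X' p'" "is_path A Y q" "is_path A Y' q'"
      "is_path A Z r" "is_path A Z' r'"
      "path_cod A X p = Y" "path_cod A X' p' = Y'" "path_cod A Y q = Z" "path_cod A Y' q' = Z'"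
      "path_comp A X p = P" "path_comp A X' p' = P'" "path_comp A Y q = Q" "path_comp A Y' q' = Q'"
      "path_comp A Z r = R" "path_comp A Z' r' = R'"
      "a \<in> cells A" "b \<in> cells A" "c \<in> cells A" "cbot A a = ctop A b" "cbot A b = ctop A c"
      "cleft A a = P" "cright A a = P'" "cleft A b = Q" "cright A b = Q'" "cleft A c = R" "cright A c = R'"
    using assms S_corners[of X p a X' p' Y q b Y' q'] S_corners[of Y q b Y' q' Z r c Z' r']
    unfolding \<alpha> \<beta> \<gamma> P_def P'_def Q_def Q'_def R_def R'_def by auto
  note [simp] = is_path_objs[OF p(1)] is_path_objs[OF p(2)] is_path_objs[OF p(3)] is_path_objs[OF p(4)]
    is_path_objs[OF p(5)] is_path_objs[OF p(6)]
    path_comp_simps[OF p(1), simplified] path_comp_simps[OF p(2), simplified]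
    path_comp_simps[OF p(3), simplified] path_comp_simps[OF p(4), simplified]
    path_comp_simps[OF p(5), simplified] path_comp_simps[OF p(6), simplified]
  note [simp] = join_simps(5)[OF p(1), simplified] join_simps(5)[OF p(3), simplified]
    cut_simps(4)[OF p(2), simplified] cut_simps(4)[OF p(4), simplified]
  have [simp]: "hdom A (ctop A c) = Z" "hcod A (ctop A c) = Z'" "hdom A (ctop A b) = Y" "hcod A (ctop A b) = Y'"
    by simp_all
  have m1: "(join A X p q \<parallel> ((a \<oslash> b) \<parallel> cut A X' p' q')) \<oslash> c
      = (join A X p q \<oslash> hidc A R) \<parallel> (((a \<oslash> b) \<oslash> c) \<parallel> (cut A X' p' q' \<oslash> hidc A R'))"
    using interchange[of "join A X p q" "(a \<oslash> b) \<parallel> cut A X' p' q'" "hidc A R" c]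
      interchange[of "a \<oslash> b" "cut A X' p' q'" c "hidc A R'"] by simp
  have m2: "a \<oslash> (join A Y q r \<parallel> ((b \<oslash> c) \<parallel> cut A Y' q' r'))
      = (hidc A P \<oslash> join A Y q r) \<parallel> ((a \<oslash> (b \<oslash> c)) \<parallel> (hidc A P' \<oslash> cut A Y' q' r'))"
    using interchange[of "hidc A P" a "join A Y q r" "(b \<oslash> c) \<parallel> cut A Y' q' r'"]
      interchange[of a "hidc A P'" "b \<oslash> c" "cut A Y' q' r'"] by simp
  have J: "join A X (p @ q) r \<parallel> (join A X p q \<oslash> hidc A R)
      = join A X p (q @ r) \<parallel> ((hidc A P \<oslash> join A Y q r) \<parallel> assoc A R Q P)"
    using join_assoc[of X p q r] by simp
  have C: "(cut A X' p' q' \<oslash> hidc A R') \<parallel> cut A X' (p' @ q') r'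
      = assoc_inv A R' Q' P' \<parallel> ((hidc A P' \<oslash> cut A Y' q' r') \<parallel> cut A X' p' (q' @ r'))"
    using cut_assoc[of X' p' q' r'] by simp
  have n: "assoc A R Q P \<parallel> ((a \<oslash> b) \<oslash> c) = (a \<oslash> (b \<oslash> c)) \<parallel> assoc A R' Q' P'"
    using assoc_natural'[of a b c] by simp
  have "join A X (p @ q) r \<parallel> (((join A X p q \<parallel> ((a \<oslash> b) \<parallel> cut A X' p' q')) \<oslash> c) \<parallel> cut A X' (p' @ q') r')
      = (join A X (p @ q) r \<parallel> (join A X p q \<oslash> hidc A R)) \<parallel> (((a \<oslash> b) \<oslash> c)
        \<parallel> ((cut A X' p' q' \<oslash> hidc A R') \<parallel> cut A X' (p' @ q') r'))"
    unfolding m1 by simp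
  also have "\<dots> = join A X p (q @ r) \<parallel> ((hidc A P \<oslash> join A Y q r) \<parallel> ((assoc A R Q P \<parallel> ((a \<oslash> b) \<oslash> c))
        \<parallel> (assoc_inv A R' Q' P' \<parallel> ((hidc A P' \<oslash> cut A Y' q' r') \<parallel> cut A X' p' (q' @ r')))))"
    unfolding J C by simp
  also have "\<dots> = join A X p (q @ r)
      \<parallel> ((a \<oslash> (join A Y q r \<parallel> ((b \<oslash> c) \<parallel> cut A Y' q' r'))) \<parallel> cut A X' p' (q' @ r'))"
    unfolding n m2 by simp
  finally show ?thesis unfolding \<alpha> \<beta> \<gamma> by simp
qed

lemma S_interchange:
  assumes "\<alpha> \<in> cells S" "\<beta> \<in> cells S" "\<gamma> \<in> cells S" "\<delta> \<in> cells S"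
    "cright S \<alpha> = cleft S \<beta>" "cright S \<gamma> = cleft S \<delta>" "cbot S \<alpha> = ctop S \<gamma>" "cbot S \<beta> = ctop S \<delta>"
  shows "(\<alpha> \<parallel>\<^bsub>S\<^esub> \<beta>) \<oslash>\<^bsub>S\<^esub> (\<gamma> \<parallel>\<^bsub>S\<^esub> \<delta>) = (\<alpha> \<oslash>\<^bsub>S\<^esub> \<gamma>) \<parallel>\<^bsub>S\<^esub> (\<beta> \<oslash>\<^bsub>S\<^esub> \<delta>)"
proof -
  obtain X p a X' p' where \<alpha>: "\<alpha> = ((X, p), a, (X', p'))" by (metis surj_pair)
  obtain b X'' p'' where \<beta>: "\<beta> = ((X', p'), b, (X'', p''))"
    using assms(5) \<alpha> by (cases \<beta>) auto
  obtain Y q c Y' q' where \<gamma>: "\<gamma> = ((Y, q), c, (Y', q'))" by (metis surj_pair)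
  obtain d Y'' q'' where \<delta>: "\<delta> = ((Y', q'), d, (Y'', q''))"
    using assms(6) \<gamma> by (cases \<delta>) auto
  have [simp]: "path_cod A X p = Y" "path_cod A X' p' = Y'" "path_cod A X'' p'' = Y''"
    using assms S_corners[of X p a X' p' Y q c Y' q'] S_corners[of X' p' b X'' p'' Y' q' d Y'' q'']
    unfolding \<alpha> \<beta> \<gamma> \<delta> by auto
  have [simp]: "is_path A X p" "is_path A X' p'" "is_path A X'' p''" "is_path A Y q" "is_path A Y' q'"
      "is_path A Y'' q''" "a \<in> cells A" "b \<in> cells A" "c \<in> cells A" "d \<in> cells A"
      "cbot A a = ctop A c" "cbot A b = ctop A d"
      "cleft A a = path_comp A X p" "cright A a = path_comp A X' p'"
      "cleft A b = path_comp A X' p'" "cright A b = path_comp A X'' p''"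
      "cleft A c = path_comp A Y q" "cright A c = path_comp A Y' q'"
      "cleft A d = path_comp A Y' q'" "cright A d = path_comp A Y'' q''"
    using assms unfolding \<alpha> \<beta> \<gamma> \<delta> by auto
  show ?thesis unfolding \<alpha> \<beta> \<gamma> \<delta> using interchange[of a b c d] by simp
qed

lemma S_vpaste_cell:
  assumes "is_cell S \<alpha> f v w g" "is_cell S \<beta> g v' w' h"
  shows "is_cell S (\<alpha> \<oslash>\<^bsub>S\<^esub> \<beta>) f (v' \<bullet>\<^bsub>S\<^esub> v) (w' \<bullet>\<^bsub>S\<^esub> w) h"
proof -
  obtain X p a X' p' where \<alpha>: "\<alpha> = ((X, p), a, (X', p'))" by (metis surj_pair)
  obtain Y q b Y' q' where \<beta>: "\<beta> = ((Y, q), b, (Y', q'))" by (metis surj_pair)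
  have [simp]: "path_cod A X p = Y" "path_cod A X' p' = Y'"
    using S_corners[of X p a X' p' Y q b Y' q'] assms unfolding \<alpha> \<beta> by (auto simp: is_cell_def)
  have p [simp]: "is_path A X p" "is_path A X' p'" "is_path A Y q" "is_path A Y' q'"
    "a \<in> cells A" "b \<in> cells A" "cbot A a = ctop A b" "cleft A a = path_comp A X p"
    "cright A a = path_comp A X' p'" "cleft A b = path_comp A Y q" "cright A b = path_comp A Y' q'"
    using assms unfolding \<alpha> \<beta> by (auto simp: is_cell_def)
  have [simp]: "X \<in> objs A" "X' \<in> objs A" by (rule is_path_objs, rule p)+
  show ?thesis using assms unfolding \<alpha> \<beta> by (auto simp: is_cell_def)
qed

lemma S_hidc_hpaste:
  "is_cell S \<alpha> f v w g \<Longrightarrow> hidc S v \<parallel>\<^bsub>S\<^esub> \<alpha> = \<alpha>" "is_cell S \<alpha> f v w g \<Longrightarrow> \<alpha> \<parallel>\<^bsub>S\<^esub> hidc S w = \<alpha>"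
  by (cases \<alpha>; cases v; cases w; auto simp: is_cell_def)+

lemma strictification_strict: "strict_with_companions S"
proof unfold_locales
  show "is_cell S (\<alpha> \<oslash>\<^bsub>S\<^esub> \<beta>) f (v' \<bullet>\<^bsub>S\<^esub> v) (w' \<bullet>\<^bsub>S\<^esub> w) h"
    if "is_cell S \<alpha> f v w g" "is_cell S \<beta> g v' w' h" for \<alpha> f v w g \<beta> v' w' h
    using that by (rule S_vpaste_cell)
  show "vidc S (hid S X) = hidc S (vid S X)" if "X \<in> objs S" for X
    using that vidc_hid by simp
  show "is_companion S f (companion S f) (cpsi S f) (cchi S f)" if "f \<in> hors S" for f
    using that by (auto simp: is_companion_def is_ver_def is_cell_def)
  show "\<alpha> \<oslash>\<^bsub>S\<^esub> (\<beta> \<oslash>\<^bsub>S\<^esub> \<gamma>) \<parallel>\<^bsub>S\<^esub> assoc S x' w' v' = assoc S x w v \<parallel>\<^bsub>S\<^esub> \<alpha> \<oslash>\<^bsub>S\<^esub> \<beta> \<oslash>\<^bsub>S\<^esub> \<gamma>"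
    if c: "is_cell S \<alpha> f v v' g" "is_cell S \<beta> g w w' h" "is_cell S \<gamma> h x x' k"
    for \<alpha> f v v' g \<beta> w w' h \<gamma> x x' k
  proof -
    have "\<alpha> \<oslash>\<^bsub>S\<^esub> \<beta> \<oslash>\<^bsub>S\<^esub> \<gamma> = \<alpha> \<oslash>\<^bsub>S\<^esub> (\<beta> \<oslash>\<^bsub>S\<^esub> \<gamma>)"
      using c by (intro S_vpaste_assoc) (auto simp: is_cell_def)
    moreover have "is_cell S (\<alpha> \<oslash>\<^bsub>S\<^esub> (\<beta> \<oslash>\<^bsub>S\<^esub> \<gamma>)) f (x \<bullet>\<^bsub>S\<^esub> w \<bullet>\<^bsub>S\<^esub> v) (x' \<bullet>\<^bsub>S\<^esub> w' \<bullet>\<^bsub>S\<^esub> v') k"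
      using S_vpaste_cell[OF c(1) S_vpaste_cell[OF c(2,3)]]
      by (cases v; cases w; cases x; cases v'; cases w'; cases x') simp
    moreover have "assoc S x w v = hidc S (x \<bullet>\<^bsub>S\<^esub> w \<bullet>\<^bsub>S\<^esub> v)" "assoc S x' w' v' = hidc S (x' \<bullet>\<^bsub>S\<^esub> w' \<bullet>\<^bsub>S\<^esub> v')"
      by (cases v; cases w; cases x; cases v'; cases w'; cases x'; simp)+
    ultimately show ?thesis using S_hidc_hpaste by metis
  qed
qed (auto simp: is_hor_def is_ver_def is_cell_def globular_def is_path_objs hcomp_assoc
  intro: S_interchange S_vpaste_assoc)

text \<open>A retrocell, seen as a retrocell between paths of length one. Its underlying cell does not change:
  the paths \<open>[b\<^sub>*, y']\<close> and \<open>[y, c\<^sub>*]\<close> have the composites \<open>y' \<bullet> b\<^sub>*\<close> and \<open>c\<^sub>* \<bullet> y\<close>.\<close>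

definition S_retro :: "('h, 'v, 'c) retrocell \<Rightarrow> ('h, 'o \<times> 'v list, ('o \<times> 'v list) \<times> 'c \<times> ('o \<times> 'v list)) retrocell"
  where "S_retro \<beta> = \<lparr>rtop = rtop \<beta>, rleft = (hdom A (rtop \<beta>), [rleft \<beta>]),
    rright = (hcod A (rtop \<beta>), [rright \<beta>]), rbot = rbot \<beta>,
    rcell = ((hdom A (rtop \<beta>), [companion A (rtop \<beta>), rright \<beta>]), rcell \<beta>,
             (hdom A (rtop \<beta>), [rleft \<beta>, companion A (rbot \<beta>)]))\<rparr>"

lemma S_retro_simps [simp]:
  "rtop (S_retro \<beta>) = rtop \<beta>" "rbot (S_retro \<beta>) = rbot \<beta>"
  "rleft (S_retro \<beta>) = (hdom A (rtop \<beta>), [rleft \<beta>])"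
  "rright (S_retro \<beta>) = (hcod A (rtop \<beta>), [rright \<beta>])"
  "rcell (S_retro \<beta>) = ((hdom A (rtop \<beta>), [companion A (rtop \<beta>), rright \<beta>]), rcell \<beta>,
     (hdom A (rtop \<beta>), [rleft \<beta>, companion A (rbot \<beta>)]))"
  by (simp_all add: S_retro_def)

lemma S_retro_inject: "S_retro \<beta> = S_retro \<beta>' \<Longrightarrow> \<beta> = \<beta>'"
  by (cases \<beta>; cases \<beta>') (simp add: S_retro_def)

lemma S_retro_retrocell:
  assumes "is_retrocell A \<beta>" shows "is_retrocell S (S_retro \<beta>)"
  using retrocellD[OF assms] by (simp add: is_retrocell_def is_ver_def globular_def is_cell_def)

lemma S_comp_iso [simp]:
  assumes "f \<in> hors A" "h \<in> hors A" "hcod A f = hdom A h"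
  shows "comp_iso S h f = ((hdom A f, [companion A (h \<odot> f)]), comp_iso A h f,
      (hdom A f, [companion A f, companion A h]))"
    "comp_iso_inv S h f = ((hdom A f, [companion A f, companion A h]), comp_iso_inv A h f,
      (hdom A f, [companion A (h \<odot> f)]))"
  using assms by (simp_all add: comp_iso_def comp_iso_inv_def)

text \<open>The associativity isomorphisms written out in the composite of retrocells are exactly those that
  \<open>join\<close> and \<open>cut\<close> contribute to the vertical pastings of the strictification.\<close>

lemma S_retro_comp:
  assumes "is_retrocell A \<alpha>" "is_retrocell A \<beta>" "rright \<alpha> = rleft \<beta>"
  shows "S_retro (retro_comp A \<beta> \<alpha>) = retro_comp S (S_retro \<beta>) (S_retro \<alpha>)"
proof -
  note [simp] = retrocellD[OF assms(1), unfolded assms(3)] retrocellD[OF assms(2)] assms(3)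
    composable_retrocells[OF assms]
  have "rcell (S_retro (retro_comp A \<beta> \<alpha>)) = rcell (retro_comp S (S_retro \<beta>) (S_retro \<alpha>))"
    by (simp add: retro_comp_def Let_def)
  then show ?thesis by (intro retrocell.equality) simp_all
qed

lemma retro_comp_assoc_strictiative:
  assumes r: "is_retrocell A \<alpha>" "is_retrocell A \<beta>" "is_retrocell A \<gamma>"
    and c: "rright \<alpha> = rleft \<beta>" "rright \<beta> = rleft \<gamma>"
  shows "retro_comp A \<gamma> (retro_comp A \<beta> \<alpha>) = retro_comp A (retro_comp A \<gamma> \<beta>) \<alpha>"
proof (rule S_retro_inject)
  have "retro_comp S (S_retro \<gamma>) (retro_comp S (S_retro \<beta>) (S_retro \<alpha>))
      = retro_comp S (retro_comp S (S_retro \<gamma>) (S_retro \<beta>)) (S_retro \<alpha>)"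
    using r c composable_retrocells[OF r(1,2) c(1)] composable_retrocells[OF r(2,3) c(2)]
    by (intro strict_with_companions.retro_comp_assoc_strict[OF strictification_strict] S_retro_retrocell) simp_all
  then show "S_retro (retro_comp A \<gamma> (retro_comp A \<beta> \<alpha>)) = S_retro (retro_comp A (retro_comp A \<gamma> \<beta>) \<alpha>)"
    using r c by (simp add: S_retro_comp retro_comp_is_retrocell)
qed

end

section \<open>The internal hom\<close>

text \<open>Here the normalization of the chosen companions on identities enters: it makes the comparisons for
  \<open>f1\<close> and \<open>1f\<close> trivial, and thereby makes identity retrocells neutral.\<close>

locale closed_double_category =
  companion_double_category A + chosen_companions A + left_closed A
  for A :: "('o, 'h, 'v, 'c, 'x) dblcat_hom_scheme" (structure)
begin

lemma comp_iso_hid [simp]: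
  assumes "f \<in> hors A"
  shows "hdom A f = X \<Longrightarrow> comp_iso A f (hid A X) = hidc A (companion A f)"
    "hcod A f = X \<Longrightarrow> comp_iso A (hid A X) f = hidc A (companion A f)"
    "hdom A f = X \<Longrightarrow> comp_iso_inv A f (hid A X) = hidc A (companion A f)"
    "hcod A f = X \<Longrightarrow> comp_iso_inv A (hid A X) f = hidc A (companion A f)"
proof -
  have X: "hdom A f \<in> objs A" "hcod A f \<in> objs A" using assms by simp_all
  note [simp] = X assms cpsi_hid[OF X(1)] cpsi_hid[OF X(2)] cchi_hid[OF X(1)] cchi_hid[OF X(2)]
    vidc_hid[OF X(1)] vidc_hid[OF X(2)] companion_hid[OF X(1)] companion_hid[OF X(2)]
  show "hdom A f = X \<Longrightarrow> comp_iso A f (hid A X) = hidc A (companion A f)"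
    "hcod A f = X \<Longrightarrow> comp_iso A (hid A X) f = hidc A (companion A f)"
    "hdom A f = X \<Longrightarrow> comp_iso_inv A f (hid A X) = hidc A (companion A f)"
    "hcod A f = X \<Longrightarrow> comp_iso_inv A (hid A X) f = hidc A (companion A f)"
    by (auto simp: comp_iso_def comp_iso_inv_def)
qed

lemma retro_id_simps [simp]:
  "rtop (retro_id A v) = hid A (vdom A v)" "rbot (retro_id A v) = hid A (vcod A v)"
  "rleft (retro_id A v) = v" "rright (retro_id A v) = v" "rcell (retro_id A v) = hidc A v"
  by (simp_all add: retro_id_def)

lemma retro_id_retrocell: "v \<in> vers A \<Longrightarrow> is_retrocell A (retro_id A v)"
  by (simp add: is_retrocell_def is_ver_def companion_hid globular_def is_cell_def)

lemma retro_comp_id: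
  assumes "is_retrocell A \<beta>"
  shows "retro_comp A \<beta> (retro_id A (rleft \<beta>)) = \<beta>" "retro_comp A (retro_id A (rright \<beta>)) \<beta> = \<beta>"
proof -
  note [simp] = retrocellD[OF assms] companion_hid
  have "rcell (retro_comp A \<beta> (retro_id A (rleft \<beta>))) = rcell \<beta>"
    "rcell (retro_comp A (retro_id A (rright \<beta>)) \<beta>) = rcell \<beta>"
    by (simp_all add: retro_comp_def[of A \<beta>] retro_comp_def[of A _ \<beta>] Let_def)
  then show "retro_comp A \<beta> (retro_id A (rleft \<beta>)) = \<beta>" "retro_comp A (retro_id A (rright \<beta>)) \<beta> = \<beta>"
    by (auto intro!: retrocell.equality)
qed

lemma TC_category: "category (TC A)"
  by unfold_locales
    (auto simp: TC_def retrocellD retro_id_retrocell retro_comp_id retro_comp_is_retrocell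
      retro_comp_assoc_strictiative composable_retrocells)

lemma ver_category: "category (ver_cat A)"
  by unfold_locales (auto simp: ver_cat_def)

text \<open>Pasting \<open>\<chi>\<^bsub>f\<^esub>\<close> below turns cells with bottom \<open>f\<close> into cells with identity bottom, bijectively: the
  inverse pastes \<open>\<psi>\<^bsub>f\<^esub>\<close>, below an identity cell, on the left.\<close>

lemma companion_transpose:
  assumes f: "f \<in> hors A" "u \<in> vers A" "vcod A u = hdom A f"
    and z: "is_cell A \<zeta> a (companion A f \<bullet> u) u' (hid A (hcod A f))"
  shows "\<exists>!\<xi>. is_cell A \<xi> a u u' f \<and> \<xi> \<oslash> cchi A f = \<zeta>"
proof
  note [simp] = f
  have [simp]: "\<zeta> \<in> cells A" "ctop A \<zeta> = a" "cleft A \<zeta> = companion A f \<bullet> u" "cright A \<zeta> = u'"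
    "cbot A \<zeta> = hid A (hcod A f)"
    using z by (auto simp: is_cell_def)
  have [simp]: "u' \<in> vers A" "vcod A u' = hcod A f" "a \<in> hors A" "hdom A a = vdom A u"
    using cright_ver[of \<zeta>] cell_simps[of \<zeta>] by auto
  let ?\<xi> = "(hidc A u \<oslash> cpsi A f) \<parallel> \<zeta>"
  have "(hidc A u \<oslash> cpsi A f) \<oslash> cchi A f = hidc A (companion A f \<bullet> u)"
    using assoc_natural'[of "hidc A u" "cpsi A f" "cchi A f"] by simp
  then have "?\<xi> \<oslash> cchi A f = \<zeta>"
    using interchange[of "hidc A u \<oslash> cpsi A f" \<zeta> "cchi A f" "hidc A (vid A (hcod A f))"] by simp
  then show "is_cell A ?\<xi> a u u' f \<and> ?\<xi> \<oslash> cchi A f = \<zeta>"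
    by (simp add: is_cell_def)
  fix \<xi> assume x: "is_cell A \<xi> a u u' f \<and> \<xi> \<oslash> cchi A f = \<zeta>"
  then have [simp]: "\<xi> \<in> cells A" "ctop A \<xi> = a" "cleft A \<xi> = u" "cright A \<xi> = u'" "cbot A \<xi> = f"
    by (auto simp: is_cell_def)
  have "(hidc A u \<parallel> \<xi>) \<oslash> (cpsi A f \<parallel> cchi A f) = (hidc A u \<oslash> cpsi A f) \<parallel> (\<xi> \<oslash> cchi A f)"
    by (rule interchange) simp_all
  then show "\<xi> = ?\<xi>" using x by simp
qed

lemma lev_simps [simp]:
  assumes "y \<in> vers A" "z \<in> vers A" "vcod A y = vcod A z"
  shows "y \<setminus> z \<in> vers A" "vdom A (y \<setminus> z) = vdom A z" "vcod A (y \<setminus> z) = vdom A y"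
    "lev A y z \<in> cells A" "ctop A (lev A y z) = hid A (vdom A z)" "cleft A (lev A y z) = y \<bullet> (y \<setminus> z)"
    "cright A (lev A y z) = z" "cbot A (lev A y z) = hid A (vcod A z)"
  using strong_left_hom[OF assms] assms
  by (auto simp: is_strong_left_hom_def is_ver_def globular_def is_cell_def)

text \<open>By naturality of associativity, the equation for \<open>\<xi>\<close> says that the cell \<open>\<xi> \<oslash> \<chi>\<^bsub>b\<^esub>\<close> corresponds to a
  prescribed cell under the universal property of \<open>y' \<setminus> z'\<close>. This determines \<open>\<xi> \<oslash> \<chi>\<^bsub>b\<^esub>\<close>, hence \<open>\<xi>\<close>.\<close>

lemma is_lhom_cell_unique:
  assumes r: "is_retrocell A \<beta>" and g: "\<gamma> \<in> cells A" "rbot \<beta> = cbot A \<gamma>"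
  shows "\<exists>!\<xi>. is_lhom_cell A \<beta> \<gamma> \<xi>"
proof -
  define y where "y = rleft \<beta>"
  define y' where "y' = rright \<beta>"
  define z where "z = cleft A \<gamma>"
  define z' where "z' = cright A \<gamma>"
  define u where "u = y \<setminus> z"
  define u' where "u' = y' \<setminus> z'"
  define a where "a = ctop A \<gamma>"
  define b where "b = rtop \<beta>"
  define c where "c = rbot \<beta>"
  let ?K = "companion A"
  define R where "R = (hidc A u \<oslash> rcell \<beta>) \<parallel> assoc A (?K c) y u \<parallel> (lev A y z \<oslash> hidc A (?K c))
    \<parallel> (\<gamma> \<oslash> cchi A c)"
  have raw: "is_lhom_cell A \<beta> \<gamma> \<xi> \<longleftrightarrow> is_cell A \<xi> a u u' b
      \<and> \<xi> \<oslash> (cchi A b \<oslash> hidc A y') \<parallel> lev A y' z' = R" for \<xi>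
    by (simp only: is_lhom_cell_def Let_def R_def y_def y'_def z_def z'_def u_def u'_def a_def b_def c_def)
  have [simp]: "b \<in> hors A" "c \<in> hors A" "y \<in> vers A" "y' \<in> vers A" "vdom A y = hdom A b"
    "vcod A y = hdom A c" "vdom A y' = hcod A b" "vcod A y' = hcod A c"
    "rcell \<beta> \<in> cells A" "ctop A (rcell \<beta>) = hid A (hdom A b)" "cleft A (rcell \<beta>) = y' \<bullet> ?K b"
    "cright A (rcell \<beta>) = ?K c \<bullet> y" "cbot A (rcell \<beta>) = hid A (hcod A c)"
    using retrocellD[OF r] by (simp_all add: y_def y'_def b_def c_def)
  have [simp]: "\<gamma> \<in> cells A" "ctop A \<gamma> = a" "cleft A \<gamma> = z" "cright A \<gamma> = z'" "cbot A \<gamma> = c"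
    "z \<in> vers A" "z' \<in> vers A" "a \<in> hors A"
    using g by (simp_all add: z_def z'_def a_def c_def)
  have [simp]: "vdom A z = hdom A a" "vcod A z = hdom A c" "vdom A z' = hcod A a" "vcod A z' = hcod A c"
    using cell_simps[of \<gamma>] by simp_all
  have [simp]: "u \<in> vers A" "vdom A u = hdom A a" "vcod A u = hdom A b"
    "u' \<in> vers A" "vdom A u' = hcod A a" "vcod A u' = hcod A b"
    "lev A y z \<in> cells A" "ctop A (lev A y z) = hid A (hdom A a)" "cleft A (lev A y z) = y \<bullet> u"
    "cright A (lev A y z) = z" "cbot A (lev A y z) = hid A (hdom A c)"
    "lev A y' z' \<in> cells A" "ctop A (lev A y' z') = hid A (hcod A a)" "cleft A (lev A y' z') = y' \<bullet> u'"
    "cright A (lev A y' z') = z'" "cbot A (lev A y' z') = hid A (hcod A c)"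
    by (simp_all add: u_def u'_def)
  have R [simp]: "R \<in> cells A" "ctop A R = a" "cleft A R = (y' \<bullet> ?K b) \<bullet> u" "cright A R = z'"
      "cbot A R = hid A (hcod A c)"
    unfolding R_def by simp_all
  have lhom: "is_lhom_cell A \<beta> \<gamma> \<xi> \<longleftrightarrow> is_cell A \<xi> a u u' b \<and>
      (\<xi> \<oslash> cchi A b) \<oslash> hidc A y' \<parallel> lev A y' z' = assoc_inv A y' (?K b) u \<parallel> R" for \<xi>
  proof -
    have "\<xi> \<oslash> (cchi A b \<oslash> hidc A y') \<parallel> lev A y' z' = R \<longleftrightarrow>
        (\<xi> \<oslash> cchi A b) \<oslash> hidc A y' \<parallel> lev A y' z' = assoc_inv A y' (?K b) u \<parallel> R"
      if "is_cell A \<xi> a u u' b"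
    proof -
      have [simp]: "\<xi> \<in> cells A" "ctop A \<xi> = a" "cleft A \<xi> = u" "cright A \<xi> = u'" "cbot A \<xi> = b"
        using that by (auto simp: is_cell_def)
      have "\<xi> \<oslash> (cchi A b \<oslash> hidc A y') = assoc A y' (?K b) u \<parallel> (\<xi> \<oslash> cchi A b) \<oslash> hidc A y'"
        using assoc_natural'[of \<xi> "cchi A b" "hidc A y'"] by simp
      then have eq: "\<xi> \<oslash> (cchi A b \<oslash> hidc A y') \<parallel> lev A y' z'
          = assoc A y' (?K b) u \<parallel> ((\<xi> \<oslash> cchi A b) \<oslash> hidc A y' \<parallel> lev A y' z')"
        by simp
      show ?thesis
      proof
        assume "\<xi> \<oslash> (cchi A b \<oslash> hidc A y') \<parallel> lev A y' z' = R"
        then show "(\<xi> \<oslash> cchi A b) \<oslash> hidc A y' \<parallel> lev A y' z' = assoc_inv A y' (?K b) u \<parallel> R"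
          unfolding eq by (auto simp del: R)
      next
        assume "(\<xi> \<oslash> cchi A b) \<oslash> hidc A y' \<parallel> lev A y' z' = assoc_inv A y' (?K b) u \<parallel> R"
        then show "\<xi> \<oslash> (cchi A b \<oslash> hidc A y') \<parallel> lev A y' z' = R" unfolding eq by simp
      qed
    qed
    then show ?thesis unfolding raw by blast
  qed
  have "\<exists>!\<zeta>. is_cell A \<zeta> a (?K b \<bullet> u) u' (hid A (vdom A y'))
      \<and> \<zeta> \<oslash> hidc A y' \<parallel> lev A y' z' = assoc_inv A y' (?K b) u \<parallel> R"
  proof -
    have "is_strong_left_hom A y' z' u' (lev A y' z')"
      unfolding u'_def by (rule strong_left_hom) simp_all
    moreover have "is_hor A a (hdom A a) (vdom A z')" "is_ver A (?K b \<bullet> u) (hdom A a) (vdom A y')"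
      "is_cell A (assoc_inv A y' (?K b) u \<parallel> R) a (y' \<bullet> (?K b \<bullet> u)) z' (hid A (vcod A z'))"
      by (simp_all add: is_hor_def is_ver_def is_cell_def)
    ultimately show ?thesis unfolding is_strong_left_hom_def by blast
  qed
  then obtain \<zeta> where \<zeta>: "is_cell A \<zeta> a (?K b \<bullet> u) u' (hid A (hcod A b))"
      "\<zeta> \<oslash> hidc A y' \<parallel> lev A y' z' = assoc_inv A y' (?K b) u \<parallel> R"
    and uniq: "\<And>\<zeta>'. is_cell A \<zeta>' a (?K b \<bullet> u) u' (hid A (hcod A b)) \<Longrightarrow>
      \<zeta>' \<oslash> hidc A y' \<parallel> lev A y' z' = assoc_inv A y' (?K b) u \<parallel> R \<Longrightarrow> \<zeta>' = \<zeta>"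
    by auto
  have "is_cell A \<xi> a u u' b \<Longrightarrow> is_cell A (\<xi> \<oslash> cchi A b) a (?K b \<bullet> u) u' (hid A (hcod A b))" for \<xi>
    by (auto simp: is_cell_def)
  then have "is_lhom_cell A \<beta> \<gamma> \<xi> \<longleftrightarrow> is_cell A \<xi> a u u' b \<and> \<xi> \<oslash> cchi A b = \<zeta>" for \<xi>
    unfolding lhom using \<zeta>(2) uniq by blast
  then show ?thesis using companion_transpose[OF _ _ _ \<zeta>(1)] by simp
qed

lemma lhom_cell:
  assumes "is_retrocell A \<beta>" "\<gamma> \<in> cells A" "rbot \<beta> = cbot A \<gamma>"
  shows "is_lhom_cell A \<beta> \<gamma> (lhom_cell A \<beta> \<gamma>)"
  unfolding lhom_cell_def by (rule theI') (rule is_lhom_cell_unique[OF assms])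

lemma lhom_cell_eqI:
  assumes "is_retrocell A \<beta>" "\<gamma> \<in> cells A" "rbot \<beta> = cbot A \<gamma>" "is_lhom_cell A \<beta> \<gamma> \<xi>"
  shows "lhom_cell A \<beta> \<gamma> = \<xi>"
  using is_lhom_cell_unique[OF assms(1-3)] lhom_cell[OF assms(1-3)] assms(4) by blast

lemma lhom_cell_id:
  assumes "y \<in> vers A" "z \<in> vers A" "vcod A y = vcod A z"
  shows "lhom_cell A (retro_id A y) (hidc A z) = hidc A (y \<setminus> z)"
proof (rule lhom_cell_eqI)
  show "is_lhom_cell A (retro_id A y) (hidc A z) (hidc A (y \<setminus> z))"
    using assms by (simp add: is_lhom_cell_def is_cell_def companion_hid cchi_hid)
qed (use assms in \<open>simp_all add: retro_id_retrocell\<close>)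

text \<open>Read in the strictification, with \<open>u = y \<setminus> z\<close> and \<open>z\<close> as paths of length one and the evaluation cell
  as a cell from \<open>[u, y]\<close> to \<open>[z]\<close>, the defining equation of \<open>\<beta> \<setminus> \<gamma>\<close> has no associativity isomorphism
  left, and \<open>hom_equation_comp\<close> applies.\<close>

lemma is_lhom_cell_comp:
  assumes r: "is_retrocell A \<beta>" "is_retrocell A \<beta>'" "rright \<beta> = rleft \<beta>'"
    and g: "\<gamma> \<in> cells A" "\<gamma>' \<in> cells A" "cright A \<gamma> = cleft A \<gamma>'" "rbot \<beta> = cbot A \<gamma>" "rbot \<beta>' = cbot A \<gamma>'"
    and x: "is_lhom_cell A \<beta> \<gamma> \<xi>" "is_lhom_cell A \<beta>' \<gamma>' \<xi>'"
  shows "is_lhom_cell A (retro_comp A \<beta>' \<beta>) (\<gamma> \<parallel> \<gamma>') (\<xi> \<parallel> \<xi>')"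
proof -
  note [simp] = retrocellD[OF r(1), unfolded r(3)] retrocellD[OF r(2)] r(3) composable_retrocells[OF r]
    g(1-3) g(4,5)[symmetric]
  define y where "y = rleft \<beta>"
  define y' where "y' = rleft \<beta>'"
  define y'' where "y'' = rright \<beta>'"
  define z where "z = cleft A \<gamma>"
  define z' where "z' = cleft A \<gamma>'"
  define z'' where "z'' = cright A \<gamma>'"
  define X where "X = vdom A z"
  define X' where "X' = vdom A z'"
  define X'' where "X'' = vdom A z''"
  define u where "u = y \<setminus> z"
  define u' where "u' = y' \<setminus> z'"
  define u'' where "u'' = y'' \<setminus> z''"
  note defs = y_def y'_def y''_def z_def z'_def z''_def X_def X'_def X''_def u_def u'_def u''_def
  let ?b = "rtop \<beta>" and ?b' = "rtop \<beta>'" and ?c = "rbot \<beta>" and ?c' = "rbot \<beta>'" and ?K = "companion A"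
  have xi: "is_cell A \<xi> (ctop A \<gamma>) u u' ?b" "is_cell A \<xi>' (ctop A \<gamma>') u' u'' ?b'"
    and E: "\<xi> \<oslash> (cchi A ?b \<oslash> hidc A y') \<parallel> lev A y' z'
      = (hidc A u \<oslash> rcell \<beta>) \<parallel> assoc A (?K ?c) y u \<parallel> (lev A y z \<oslash> hidc A (?K ?c)) \<parallel> (\<gamma> \<oslash> cchi A ?c)"
    and E': "\<xi>' \<oslash> (cchi A ?b' \<oslash> hidc A y'') \<parallel> lev A y'' z''
      = (hidc A u' \<oslash> rcell \<beta>') \<parallel> assoc A (?K ?c') y' u' \<parallel> (lev A y' z' \<oslash> hidc A (?K ?c'))
        \<parallel> (\<gamma>' \<oslash> cchi A ?c')"
    using x unfolding is_lhom_cell_def Let_def defs r(3) g(3) by auto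
  have goal: "is_lhom_cell A (retro_comp A \<beta>' \<beta>) (\<gamma> \<parallel> \<gamma>') (\<xi> \<parallel> \<xi>') \<longleftrightarrow>
      is_cell A (\<xi> \<parallel> \<xi>') (ctop A (\<gamma> \<parallel> \<gamma>')) u u'' (?b' \<odot> ?b) \<and>
      (\<xi> \<parallel> \<xi>') \<oslash> (cchi A (?b' \<odot> ?b) \<oslash> hidc A y'') \<parallel> lev A y'' z''
      = (hidc A u \<oslash> rcell (retro_comp A \<beta>' \<beta>)) \<parallel> assoc A (?K (?c' \<odot> ?c)) y u
        \<parallel> (lev A y z \<oslash> hidc A (?K (?c' \<odot> ?c))) \<parallel> ((\<gamma> \<parallel> \<gamma>') \<oslash> cchi A (?c' \<odot> ?c))"
    using g(1-3) unfolding is_lhom_cell_def Let_def defs by simp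
  have rc: "is_retrocell A (retro_comp A \<beta>' \<beta>)" by (rule retro_comp_is_retrocell[OF r])
  have [simp]: "rleft \<beta> = y" "rleft \<beta>' = y'" "rright \<beta>' = y''" "cleft A \<gamma> = z" "cleft A \<gamma>' = z'"
      "cright A \<gamma>' = z''" "vdom A z = X" "vdom A z' = X'" "vdom A z'' = X''"
    by (simp_all add: defs)
  have [simp]: "y \<in> vers A" "y' \<in> vers A" "y'' \<in> vers A" "vdom A y = hdom A ?b" "vdom A y' = hdom A ?b'"
      "vdom A y'' = hcod A ?b'" "vcod A y = hdom A ?c" "vcod A y' = hdom A ?c'" "vcod A y'' = hcod A ?c'"
    using retrocellD[OF r(1)] retrocellD[OF r(2)] by simp_all
  have [simp]: "z \<in> vers A" "z' \<in> vers A" "z'' \<in> vers A"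
    using cleft_ver[of \<gamma>] cleft_ver[of \<gamma>'] cright_ver[of \<gamma>'] by simp_all
  have [simp]: "vcod A z = hdom A ?c" "vcod A z' = hdom A ?c'" "vcod A z'' = hcod A ?c'"
    using cell_simps(5,6)[of \<gamma>] cell_simps(5,6)[of \<gamma>'] by simp_all
  have [simp]: "X \<in> objs A" "X' \<in> objs A" "X'' \<in> objs A"
    using vdom_obj[of z] vdom_obj[of z'] vdom_obj[of z''] by simp_all
  have [simp]: "u \<in> vers A" "u' \<in> vers A" "u'' \<in> vers A" "vdom A u = X" "vdom A u' = X'" "vdom A u'' = X''"
      "vcod A u = hdom A ?b" "vcod A u' = hdom A ?b'" "vcod A u'' = hcod A ?b'"
      "lev A y z \<in> cells A" "lev A y' z' \<in> cells A" "lev A y'' z'' \<in> cells A"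
      "cleft A (lev A y z) = y \<bullet> u" "cleft A (lev A y' z') = y' \<bullet> u'" "cleft A (lev A y'' z'') = y'' \<bullet> u''"
    unfolding u_def u'_def u''_def by simp_all
  have [simp]: "\<xi> \<in> cells A" "ctop A \<xi> = ctop A \<gamma>" "cleft A \<xi> = u" "cright A \<xi> = u'" "cbot A \<xi> = ?b"
    "\<xi>' \<in> cells A" "ctop A \<xi>' = ctop A \<gamma>'" "cleft A \<xi>' = u'" "cright A \<xi>' = u''" "cbot A \<xi>' = ?b'"
    using xi by (auto simp: is_cell_def)
  let ?B = "S_retro \<beta>" and ?B' = "S_retro \<beta>'"
  let ?g = "((X, [z]), \<gamma>, (X', [z']))" and ?g' = "((X', [z']), \<gamma>', (X'', [z'']))"
  let ?x = "((X, [u]), \<xi>, (X', [u']))" and ?x' = "((X', [u']), \<xi>', (X'', [u'']))"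
  let ?e = "((X, [u, y]), lev A y z, (X, [z]))"
  let ?e' = "((X', [u', y']), lev A y' z', (X', [z']))"
  let ?e'' = "((X'', [u'', y'']), lev A y'' z'', (X'', [z'']))"
  have eq: "(?x \<parallel>\<^bsub>S\<^esub> ?x') \<oslash>\<^bsub>S\<^esub> (cchi S (rtop ?B' \<odot>\<^bsub>S\<^esub> rtop ?B) \<oslash>\<^bsub>S\<^esub> hidc S (rright ?B')) \<parallel>\<^bsub>S\<^esub> ?e''
    = (hidc S (X, [u]) \<oslash>\<^bsub>S\<^esub> rcell (retro_comp S ?B' ?B))
      \<parallel>\<^bsub>S\<^esub> (?e \<oslash>\<^bsub>S\<^esub> hidc S (companion S (rbot ?B' \<odot>\<^bsub>S\<^esub> rbot ?B)))
      \<parallel>\<^bsub>S\<^esub> ((?g \<parallel>\<^bsub>S\<^esub> ?g') \<oslash>\<^bsub>S\<^esub> cchi S (rbot ?B' \<odot>\<^bsub>S\<^esub> rbot ?B))"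
  proof (rule strict_with_companions.hom_equation_comp[OF strictification_strict,
        where u'' = "(X'', [u''])"])
    show "is_retrocell S ?B" "is_retrocell S ?B'" using r by (simp_all only: S_retro_retrocell)
    show "?x \<oslash>\<^bsub>S\<^esub> (cchi S (rtop ?B) \<oslash>\<^bsub>S\<^esub> hidc S (rleft ?B')) \<parallel>\<^bsub>S\<^esub> ?e'
      = (hidc S (X, [u]) \<oslash>\<^bsub>S\<^esub> rcell ?B) \<parallel>\<^bsub>S\<^esub> (?e \<oslash>\<^bsub>S\<^esub> hidc S (companion S (rbot ?B)))
        \<parallel>\<^bsub>S\<^esub> (?g \<oslash>\<^bsub>S\<^esub> cchi S (rbot ?B))"
      using E by simp
    show "?x' \<oslash>\<^bsub>S\<^esub> (cchi S (rtop ?B') \<oslash>\<^bsub>S\<^esub> hidc S (rright ?B')) \<parallel>\<^bsub>S\<^esub> ?e''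
      = (hidc S (X', [u']) \<oslash>\<^bsub>S\<^esub> rcell ?B') \<parallel>\<^bsub>S\<^esub> (?e' \<oslash>\<^bsub>S\<^esub> hidc S (companion S (rbot ?B')))
        \<parallel>\<^bsub>S\<^esub> (?g' \<oslash>\<^bsub>S\<^esub> cchi S (rbot ?B'))"
      using E' by simp
  qed (simp_all add: is_cell_def globular_def)
  note [simp] = retrocellD[OF rc, simplified]
  have "(\<xi> \<parallel> \<xi>') \<oslash> (cchi A (?b' \<odot> ?b) \<oslash> hidc A y'') \<parallel> lev A y'' z''
      = (hidc A u \<oslash> rcell (retro_comp A \<beta>' \<beta>)) \<parallel> assoc A (?K (?c' \<odot> ?c)) y u
        \<parallel> (lev A y z \<oslash> hidc A (?K (?c' \<odot> ?c))) \<parallel> ((\<gamma> \<parallel> \<gamma>') \<oslash> cchi A (?c' \<odot> ?c))"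
    using eq by (simp add: S_retro_comp[OF r, symmetric])
  then show ?thesis unfolding goal by (simp add: is_cell_def)
qed

end

theorem theorem7p1:
  fixes A :: "('o, 'h, 'v, 'c) dblcat_hom"
  assumes "double_category A"
    and "chosen_companions A"
    and "left_closed A"
  shows "cat_functor (TC A) (ver_cat A)
           (\<lambda>(y, z). lhom A y z) (\<lambda>(\<beta>, \<gamma>). lhom_cell A \<beta> \<gamma>)"
proof -
  interpret closed_double_category A
    using assms by (intro closed_double_category.intro companion_double_category.intro
      companion_double_category_axioms.intro chosen_companions.companion)
  show ?thesis
  proof (intro cat_functor.intro cat_functor_axioms.intro TC_category ver_category)
    show "(case X of (y, z) \<Rightarrow> lhom A y z) \<in> Obj (ver_cat A)" if "X \<in> Obj (TC A)" for X
      using that by (auto simp: TC_def ver_cat_def)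
    show "(case f of (\<beta>, \<gamma>) \<Rightarrow> lhom_cell A \<beta> \<gamma>) \<in> Arr (ver_cat A)"
      "Dom (ver_cat A) (case f of (\<beta>, \<gamma>) \<Rightarrow> lhom_cell A \<beta> \<gamma>) = (case Dom (TC A) f of (y, z) \<Rightarrow> lhom A y z)"
      "Cod (ver_cat A) (case f of (\<beta>, \<gamma>) \<Rightarrow> lhom_cell A \<beta> \<gamma>) = (case Cod (TC A) f of (y, z) \<Rightarrow> lhom A y z)"
      if "f \<in> Arr (TC A)" for f
      using that lhom_cell[of "fst f" "snd f"]
      by (auto simp: TC_def ver_cat_def is_lhom_cell_def Let_def is_cell_def)
    show "(case Id (TC A) X of (\<beta>, \<gamma>) \<Rightarrow> lhom_cell A \<beta> \<gamma>)
        = Id (ver_cat A) (case X of (y, z) \<Rightarrow> lhom A y z)" if "X \<in> Obj (TC A)" for X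
      using that by (auto simp: TC_def ver_cat_def lhom_cell_id)
    show "(case Comp (TC A) g f of (\<beta>, \<gamma>) \<Rightarrow> lhom_cell A \<beta> \<gamma>)
        = Comp (ver_cat A) (case g of (\<beta>, \<gamma>) \<Rightarrow> lhom_cell A \<beta> \<gamma>) (case f of (\<beta>, \<gamma>) \<Rightarrow> lhom_cell A \<beta> \<gamma>)"
      if "f \<in> Arr (TC A)" "g \<in> Arr (TC A)" "Cod (TC A) f = Dom (TC A) g" for f g
      using that
      by (auto simp: TC_def ver_cat_def retro_comp_is_retrocell
        intro!: lhom_cell_eqI is_lhom_cell_comp lhom_cell)
  qed
qed

end
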